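(* Let $\beta>0$. There exists a constant $c>1$ (which may depend on $\beta$ but does not depend on $R$) such that the following holds for every $R>0$. Let $(\Theta_n)_n$ be a sequence of sets of probability densities on $[0,1]$, and let $(f_{0,n})_n$ be a sequence with $f_{0,n}\in \Theta_n\cap \mathcal{H}^\beta(R)$ for all $n$, such that for all $n\ge 2$ $$\inf_{x\in[0,1]} f_{0,n}(x)\le \tfrac12 R^{1/(\beta+1)} n^{-\beta/(\beta+1)}$$ and $$\{f\in\mathcal{H}^\beta(cR): c^{-1}f_{0,n}\le f\le c f_{0,n}\}\subset\Theta_n .$$ Then, as $n\to\infty$, $$\delta\big(\mathcal{E}_n^D(\Theta_n),\mathcal{E}_n^G(\Theta_n)\big)\ge 0.007+o(1)>0,$$ where the last inequality is understood for all sufficiently large $n$; equivalently, $\liminf_{n\to\infty}\delta(\mathcal{E}_n^D(\Theta_n),\mathcal{E}_n^G(\Theta_n))\ge 0.007$.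
   Context: Function spaces. For $\beta>0$, $\lfloor\beta\rfloor$ denotes the largest integer strictly smaller than $\beta$. For $f:[0,1]\to\mathbb{R}$ whose derivative $f^{(\lfloor\beta\rfloor)}$ exists, set $$|f|_{\mathcal{C}^\beta}=\sup_{x\ne y,\ x,y\in[0,1]}\frac{|f^{(\lfloor\beta\rfloor)}(x)-f^{(\lfloor\beta\rfloor)}(y)|}{|x-y|^{\beta-\lfloor\beta\rfloor}},\qquad \|f\|_{\mathcal{C}^\beta}=\|f\|_\infty+\|f^{(\lfloor\beta\rfloor)}\|_\infty+|f|_{\mathcal{C}^\beta}.$$ $\mathcal{C}^\beta(R)$ is the set of $f:[0,1]\to\mathbb{R}$ with $f\ge0$, $\int_0^1 f=1$, $f^{(\lfloor\beta\rfloor)}$ existing and $\|f\|_{\mathcal{C}^\beta}\le R$. The flatness seminorm is $$|f|_{\mathcal{H}^\beta}=\max_{j\in\mathbb{Z},\,1\le j<\beta}\Big(\sup_{x\in[0,1]}\frac{|f^{(j)}(x)|^\beta}{|f(x)|^{\beta-j}}\Big)^{1/j},$$ with $0/0:=0$, and $|f|_{\mathcal{H}^\beta}:=0$ if $0<\beta\le1$. Put $\|f\|_{\mathcal{H}^\beta}=\|f\|_{\mathcal{C}^\beta}+|f|_{\mathcal{H}^\beta}$ and $\mathcal{H}^\beta(R)=\{f\in\mathcal{C}^\beta(R):\|f\|_{\mathcal{H}^\beta}\le R\}$. For functions, $f\le g$ means $f(x)\le g(x)$ for all $x\in[0,1]$. Experiments. For a set $\Theta$ of probability densities on $[0,1]$: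 $\mathcal{E}_n^D(\Theta)=([0,1]^n,\mathrm{Borel},(P_f^n:f\in\Theta))$, where $P_f^n$ is the law of $n$ i.i.d. random variables with Lebesgue density $f$; $\mathcal{E}_n^G(\Theta)=(\mathcal{C}([0,1]),\mathrm{Borel},(Q_f^n:f\in\Theta))$, where $\mathcal{C}([0,1])$ is the space of continuous functions with the uniform norm and $Q_f^n$ is the law of $(Y_t)_{t\in[0,1]}$ with $Y_0=0$ and $dY_t=2\sqrt{f(t)}\,dt+n^{-1/2}dW_t$, $W$ a standard Brownian motion. Le Cam deficiency. The total variation distance is $\|P-Q\|_{\mathrm{TV}}=\tfrac12\int|p-q|\,d\nu$, with $p,q$ densities of $P,Q$ with respect to a dominating measure $\nu$. For experiments $\mathcal{E}(\Theta)=(\Omega,\mathcal{A},(P_\theta)_{\theta\in\Theta})$ and $\mathcal{F}(\Theta)=(\Omega',\mathcal{A}',(Q_\theta)_{\theta\in\Theta})$ (Polish and dominated) with the same parameter set, $\delta(\mathcal{E}(\Theta),\mathcal{F}(\Theta))=\inf_M\sup_{\theta\in\Theta}\|MP_\theta-Q_\theta\|_{\mathrm{TV}}$, the infimum being over all Markov kernels $M:\Omega\times\mathcal{A}'\to[0,1]$, where $MP(A)=\int M(\omega,A)\,dP(\omega)$. *)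

theory Defs
  imports "HOL-Probability.Probability"
begin

text \<open>
  Functions on $[0,1]$ are extensional functions on \<open>{0..1} :: real set\<close>, so that equality of
  functions and membership in a class depend on the values on $[0,1]$ only.
  Norms take values in \<^typ>\<open>ennreal\<close>; a norm of an unbounded function is \<open>\<infinity>\<close>.
\<close>

section \<open>Function spaces\<close>

text \<open>The iterated derivative on $[0,1]$, one-sided at the end points.\<close>

definition nderiv01 :: "nat \<Rightarrow> (real \<Rightarrow> real) \<Rightarrow> real \<Rightarrow> real" where
  "nderiv01 k = (\<lambda>f x. vector_derivative f (at x within {0..1})) ^^ k"

definition has_nderiv01 :: "nat \<Rightarrow> (real \<Rightarrow> real) \<Rightarrow> bool" where
  "has_nderiv01 k f \<longleftrightarrow> (\<forall>j<k. nderiv01 j f differentiable_on {0..1})"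

text \<open>The largest integer strictly smaller than \<open>\<beta>\<close> (not the usual floor).\<close>

definition sfloor :: "real \<Rightarrow> nat" where
  "sfloor \<beta> = nat (\<lceil>\<beta>\<rceil> - 1)"

lemma sfloor_eq_iff: "\<beta> > 0 \<Longrightarrow> sfloor \<beta> = k \<longleftrightarrow> real k < \<beta> \<and> \<beta> \<le> real k + 1"
  unfolding sfloor_def by (auto simp: ceiling_eq_iff) linarith+

definition supnorm01 :: "(real \<Rightarrow> real) \<Rightarrow> ennreal" where
  "supnorm01 f = (SUP x\<in>{0..1}. ennreal \<bar>f x\<bar>)"

definition holder_seminorm :: "real \<Rightarrow> (real \<Rightarrow> real) \<Rightarrow> ennreal" where
  "holder_seminorm \<beta> f =
     (SUP (x, y) \<in> {(x, y). x \<in> {0..1} \<and> y \<in> {0..1} \<and> x \<noteq> y}.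
        ennreal (\<bar>nderiv01 (sfloor \<beta>) f x - nderiv01 (sfloor \<beta>) f y\<bar>
                 / \<bar>x - y\<bar> powr (\<beta> - real (sfloor \<beta>))))"

definition holder_norm :: "real \<Rightarrow> (real \<Rightarrow> real) \<Rightarrow> ennreal" where
  "holder_norm \<beta> f =
     supnorm01 f + supnorm01 (nderiv01 (sfloor \<beta>) f) + holder_seminorm \<beta> f"

text \<open>The probability densities on $[0,1]$; a set integral equal to 1 implies integrability.\<close>

definition densities01 :: "(real \<Rightarrow> real) set" where
  "densities01 =
     {f \<in> extensional {0..1}. f \<in> borel_measurable (restrict_space borel {0..1}) \<and>
        (\<forall>x\<in>{0..1}. 0 \<le> f x) \<and> (LBINT x:{0..1}. f x) = 1}"

definition holder_class :: "real \<Rightarrow> real \<Rightarrow> (real \<Rightarrow> real) set" where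
  "holder_class \<beta> R =
     {f \<in> extensional {0..1}. (\<forall>x\<in>{0..1}. 0 \<le> f x) \<and> (LBINT x:{0..1}. f x) = 1 \<and>
        has_nderiv01 (sfloor \<beta>) f \<and> holder_norm \<beta> f \<le> ennreal R}"

definition ennreal_root :: "nat \<Rightarrow> ennreal \<Rightarrow> ennreal" where
  "ennreal_root j a = (if a = \<infinity> then \<infinity> else ennreal (root j (enn2real a)))"

text \<open>
  Division on \<^typ>\<open>ennreal\<close> satisfies $0/0 = 0$ and $a/0 = \infty$ for $a > 0$. The
  supremum over \<open>j\<close> is over a finite set and is 0 if that set is empty, i.e. if \<open>\<beta> \<le> 1\<close>.
\<close>

definition flat_seminorm :: "real \<Rightarrow> (real \<Rightarrow> real) \<Rightarrow> ennreal" where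
  "flat_seminorm \<beta> f =
     (SUP j \<in> {j::nat. 1 \<le> j \<and> real j < \<beta>}.
        ennreal_root j (SUP x\<in>{0..1}.
          ennreal (\<bar>nderiv01 j f x\<bar> powr \<beta>) / ennreal (\<bar>f x\<bar> powr (\<beta> - real j))))"

definition flat_norm :: "real \<Rightarrow> (real \<Rightarrow> real) \<Rightarrow> ennreal" where
  "flat_norm \<beta> f = holder_norm \<beta> f + flat_seminorm \<beta> f"

definition flat_class :: "real \<Rightarrow> real \<Rightarrow> (real \<Rightarrow> real) set" where
  "flat_class \<beta> R = {f \<in> holder_class \<beta> R. flat_norm \<beta> f \<le> ennreal R}"


section \<open>Density estimation\<close>

definition iid_space :: "nat \<Rightarrow> (nat \<Rightarrow> real) measure" where
  "iid_space n = Pi\<^sub>M {..<n} (\<lambda>_. restrict_space borel {0..1})"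

definition iid_law :: "nat \<Rightarrow> (real \<Rightarrow> real) \<Rightarrow> (nat \<Rightarrow> real) measure" where
  "iid_law n f = Pi\<^sub>M {..<n} (\<lambda>_. density (restrict_space lborel {0..1}) (\<lambda>x. ennreal (f x)))"

lemma sets_iid_law [simp]: "sets (iid_law n f) = sets (iid_space n)"
  unfolding iid_law_def iid_space_def
  by (intro sets_PiM_cong) (auto simp: sets_restrict_space)

lemma densities01_integrable:
  assumes "f \<in> densities01"
  shows "set_integrable lborel {0..1} f"
  using assms not_integrable_integral_eq[of lborel "\<lambda>x. indicator {0..1} x *\<^sub>R f x"]
  by (auto simp: densities01_def set_integrable_def set_lebesgue_integral_def)

lemma prob_space_iid_law:
  assumes f: "f \<in> densities01"
  shows "prob_space (iid_law n f)"
  unfolding iid_law_def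
proof (intro prob_space_PiM prob_spaceI)
  let ?L = "restrict_space lborel {0..1::real}"
  have m: "f \<in> borel_measurable ?L"
    using f by (subst measurable_cong_sets[of ?L "restrict_space borel {0..1}" borel borel])
      (auto simp: densities01_def sets_restrict_space)
  have i: "integrable lborel (\<lambda>x. indicator {0..1} x *\<^sub>R f x)"
    using densities01_integrable[OF f] by (simp add: set_integrable_def)
  have "emeasure (density ?L f) (space (density ?L f)) = (\<integral>\<^sup>+x. f x \<partial>?L)"
    by (subst emeasure_density)
      (use m in \<open>auto simp: space_restrict_space sets_restrict_space intro!: nn_integral_cong\<close>)
  also have "\<dots> = (\<integral>\<^sup>+x. ennreal (f x) * indicator {0..1} x \<partial>lborel)"
    by (simp add: nn_integral_restrict_space)
  also have "\<dots> = (\<integral>\<^sup>+x. ennreal (indicator {0..1} x *\<^sub>R f x) \<partial>lborel)"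
    by (intro nn_integral_cong) (auto split: split_indicator)
  also have "\<dots> = ennreal (LBINT x:{0..1}. f x)"
    unfolding set_lebesgue_integral_def using f
    by (intro nn_integral_eq_integral[OF i]) (auto simp: densities01_def split: split_indicator)
  also have "\<dots> = 1"
    using f by (simp add: densities01_def)
  finally show "emeasure (density ?L f) (space (density ?L f)) = 1" .
qed


section \<open>Gaussian white noise\<close>

definition C01 :: "(real \<Rightarrow> real) set" where
  "C01 = {w \<in> extensional {0..1}. continuous_on {0..1} w}"

definition dist_C01 :: "(real \<Rightarrow> real) \<Rightarrow> (real \<Rightarrow> real) \<Rightarrow> real" where
  "dist_C01 u v = (if u \<in> C01 \<and> v \<in> C01 then SUP t\<in>{0..1}. \<bar>u t - v t\<bar> else 0)"

definition borel_C01 :: "(real \<Rightarrow> real) measure" where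
  "borel_C01 = sigma C01 {U. openin (Metric_space.mtopology C01 dist_C01) U}"

lemma dist_C01_upper:
  assumes "u \<in> C01" "v \<in> C01" "t \<in> {0..1}"
  shows "\<bar>u t - v t\<bar> \<le> dist_C01 u v"
proof -
  have "continuous_on {0..1} (\<lambda>t. \<bar>u t - v t\<bar>)"
    using assms by (auto simp: C01_def intro!: continuous_intros)
  then have "bdd_above ((\<lambda>t. \<bar>u t - v t\<bar>) ` {0..1})"
    by (intro bounded_imp_bdd_above compact_imp_bounded compact_continuous_image) auto
  then show ?thesis
    unfolding dist_C01_def using assms by (auto intro: cSUP_upper)
qed

lemma dist_C01_least:
  assumes "\<And>t. t \<in> {0..1} \<Longrightarrow> \<bar>u t - v t\<bar> \<le> b" "u \<in> C01" "v \<in> C01"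
  shows "dist_C01 u v \<le> b"
  unfolding dist_C01_def using assms by (auto intro: cSUP_least)

lemma Metric_space_C01: "Metric_space C01 dist_C01"
proof
  show nonneg: "0 \<le> dist_C01 u v" for u v
    using dist_C01_upper[of u v 0] by (cases "u \<in> C01 \<and> v \<in> C01") (auto simp: dist_C01_def)
  show "dist_C01 u v = dist_C01 v u" for u v
    by (auto simp: dist_C01_def abs_minus_commute)
  show "dist_C01 u v = 0 \<longleftrightarrow> u = v" if uv: "u \<in> C01" "v \<in> C01" for u v
  proof
    assume "dist_C01 u v = 0"
    then have "u t = v t" if "t \<in> {0..1}" for t
      using dist_C01_upper[OF uv that] by auto
    then show "u = v"
      using uv by (intro extensionalityI[of u "{0..1}"]) (auto simp: C01_def)
  qed (use nonneg[of u v] dist_C01_least[of u v 0] uv in auto)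
  show "dist_C01 u w \<le> dist_C01 u v + dist_C01 v w"
    if uvw: "u \<in> C01" "v \<in> C01" "w \<in> C01" for u v w
  proof (rule dist_C01_least[OF _ uvw(1,3)])
    fix t :: real assume t: "t \<in> {0..1}"
    show "\<bar>u t - w t\<bar> \<le> dist_C01 u v + dist_C01 v w"
      using dist_C01_upper[OF uvw(1,2) t] dist_C01_upper[OF uvw(2,3) t] by linarith
  qed
qed

lemma space_borel_C01 [simp]: "space borel_C01 = C01"
  unfolding borel_C01_def
  by (intro space_measure_of)
    (auto dest!: openin_subset simp: Metric_space.topspace_mtopology[OF Metric_space_C01])

lemma sets_borel_C01:
  "sets borel_C01 = sigma_sets C01 {U. openin (Metric_space.mtopology C01 dist_C01) U}"
  unfolding borel_C01_def
  by (intro sets_measure_of)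
    (auto dest!: openin_subset simp: Metric_space.topspace_mtopology[OF Metric_space_C01])

lemma measurable_eval_C01:
  assumes t: "t \<in> {0..1}"
  shows "(\<lambda>w. w t) \<in> borel_measurable borel_C01"
proof (rule borel_measurableI)
  interpret Metric_space C01 dist_C01 by (rule Metric_space_C01)
  fix S :: "real set" assume S: "open S"
  have "openin mtopology ((\<lambda>w. w t) -` S \<inter> C01)"
    unfolding openin_mtopology
  proof safe
    fix w assume w: "w \<in> C01" "w t \<in> S"
    obtain e where e: "e > 0" "\<And>y. dist y (w t) < e \<Longrightarrow> y \<in> S"
      using S w(2) unfolding open_dist by auto
    show "\<exists>r>0. mball w r \<subseteq> (\<lambda>w. w t) -` S \<inter> C01"
    proof (intro exI[of _ e] conjI e(1) subsetI)
      fix v assume "v \<in> mball w e"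
      then have v: "v \<in> C01" "dist_C01 w v < e" by auto
      then have "dist (v t) (w t) < e"
        using dist_C01_upper[OF w(1) v(1) t] by (simp add: dist_real_def abs_minus_commute)
      then show "v \<in> (\<lambda>w. w t) -` S \<inter> C01" using e(2) v by auto
    qed
  qed
  then show "(\<lambda>w. w t) -` S \<inter> space borel_C01 \<in> sets borel_C01"
    by (auto simp: sets_borel_C01)
qed

definition standard_brownian_motion :: "'a measure \<Rightarrow> (real \<Rightarrow> 'a \<Rightarrow> real) \<Rightarrow> bool" where
  "standard_brownian_motion M B \<longleftrightarrow>
     prob_space M \<and>
     (AE \<omega> in M. B 0 \<omega> = 0) \<and>
     (\<forall>s t. 0 \<le> s \<longrightarrow> s < t \<longrightarrow> t \<le> 1 \<longrightarrow>
        distributed M lborel (\<lambda>\<omega>. B t \<omega> - B s \<omega>)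
          (\<lambda>x. ennreal (normal_density 0 (sqrt (t - s)) x))) \<and>
     (\<forall>(\<tau>::nat \<Rightarrow> real) m. mono_on {..m} \<tau> \<longrightarrow> \<tau> ` {..m} \<subseteq> {0..1} \<longrightarrow>
        prob_space.indep_vars M (\<lambda>_. borel) (\<lambda>i \<omega>. B (\<tau> (Suc i)) \<omega> - B (\<tau> i) \<omega>) {..<m}) \<and>
     (\<forall>\<omega>\<in>space M. continuous_on {0..1} (\<lambda>t. B t \<omega>))"

text \<open>
  The law of a standard Brownian motion on $[0,1]$, characterised by the coordinate process being
  a standard Brownian motion.
\<close>

definition wiener_measure :: "(real \<Rightarrow> real) measure \<Rightarrow> bool" where
  "wiener_measure W \<longleftrightarrow>
     sets W = sets borel_C01 \<and> standard_brownian_motion W (\<lambda>t w. w t)"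

text \<open>
  The law of $Y_t = 2\int_0^t \sqrt{f(s)}\,ds + n^{-1/2} W_t$, given the law \<open>W\<close> of the
  Brownian motion.
\<close>

definition white_noise_path :: "nat \<Rightarrow> (real \<Rightarrow> real) \<Rightarrow> (real \<Rightarrow> real) \<Rightarrow> real \<Rightarrow> real" where
  "white_noise_path n f w = (\<lambda>t\<in>{0..1}. 2 * (LBINT s:{0..t}. sqrt (f s)) + w t / sqrt (real n))"

definition white_noise_law ::
    "(real \<Rightarrow> real) measure \<Rightarrow> nat \<Rightarrow> (real \<Rightarrow> real) \<Rightarrow> (real \<Rightarrow> real) measure" where
  "white_noise_law W n f = distr W borel_C01 (white_noise_path n f)"

lemma sets_white_noise_law [simp]: "sets (white_noise_law W n f) = sets borel_C01"
  by (simp add: white_noise_law_def)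

lemma white_noise_path_C01:
  assumes f: "f \<in> densities01" and w: "w \<in> C01"
  shows "white_noise_path n f w \<in> C01"
proof -
  have meas: "(\<lambda>x. indicator {0..1} x * sqrt (f x)) \<in> borel_measurable lborel"
  proof -
    have "(\<lambda>x. sqrt (f x)) \<in> borel_measurable (restrict_space borel {0..1})"
      using f by (auto simp: densities01_def)
    then show ?thesis
      by (subst (asm) borel_measurable_restrict_space_iff) auto
  qed
  have int: "set_integrable lborel {0..1} (\<lambda>x. sqrt (f x))"
    unfolding set_integrable_def
  proof (rule Bochner_Integration.integrable_bound)
    have "integrable lborel (\<lambda>x::real. indicator {0..1} x *\<^sub>R (1::real))"
      by (simp add: integrable_indicator_iff emeasure_lborel_Icc_eq)
    with densities01_integrable[OF f]
    show "integrable lborel (\<lambda>x. indicator {0..1} x *\<^sub>R (1::real) + indicator {0..1} x *\<^sub>R f x)"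
      unfolding set_integrable_def by (rule Bochner_Integration.integrable_add[rotated])
    show "AE x in lborel. norm (indicator {0..1} x *\<^sub>R sqrt (f x))
            \<le> norm (indicator {0..1} x *\<^sub>R (1::real) + indicator {0..1} x *\<^sub>R f x)"
    proof (intro AE_I2)
      fix x :: real
      have "sqrt y \<le> 1 + y" if "y \<ge> 0" for y
        using that by (intro real_le_lsqrt) (auto simp: power2_eq_square algebra_simps)
      then show "norm (indicator {0..1} x *\<^sub>R sqrt (f x))
            \<le> norm (indicator {0..1} x *\<^sub>R (1::real) + indicator {0..1} x *\<^sub>R f x)"
        using f by (auto simp: densities01_def split: split_indicator)
    qed
  qed (use meas in simp)
  have "(LBINT s:{0..t}. sqrt (f s)) = integral {0..t} (\<lambda>s. sqrt (f s))" if "t \<in> {0..1}" for t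
    using that by (intro set_borel_integral_eq_integral(2) set_integrable_subset[OF int]) auto
  moreover have "continuous_on {0..1} (\<lambda>t. integral {0..t} (\<lambda>s. sqrt (f s)))"
    by (intro indefinite_integral_continuous_1 set_borel_integral_eq_integral(1) int)
  ultimately have "continuous_on {0..1} (\<lambda>t. LBINT s:{0..t}. sqrt (f s))"
    using continuous_on_eq by (metis (mono_tags, lifting))
  then have "continuous_on {0..1} (\<lambda>t. 2 * (LBINT s:{0..t}. sqrt (f s)) + w t / sqrt (real n))"
    using w unfolding C01_def divide_inverse by (intro continuous_intros) auto
  then have "continuous_on {0..1} (white_noise_path n f w)"
    by (rule continuous_on_eq) (simp add: white_noise_path_def)
  then show ?thesis
    by (simp add: C01_def white_noise_path_def)
qed

lemma measurable_white_noise_path: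
  assumes f: "f \<in> densities01" and n: "n \<ge> 1"
  shows "white_noise_path n f \<in> measurable borel_C01 borel_C01"
proof -
  interpret Metric_space C01 dist_C01 by (rule Metric_space_C01)
  let ?T = "white_noise_path n f"
  note TC = white_noise_path_C01[OF f]
  have lip: "dist_C01 (?T u) (?T v) \<le> dist_C01 u v" if uv: "u \<in> C01" "v \<in> C01" for u v
  proof (rule dist_C01_least)
    fix t :: real assume t: "t \<in> {0..1}"
    have "\<bar>?T u t - ?T v t\<bar> = \<bar>u t - v t\<bar> / sqrt (real n)"
      using t n by (simp add: white_noise_path_def flip: diff_divide_distrib)
    also have "\<dots> \<le> \<bar>u t - v t\<bar> / 1"
      using n by (intro divide_left_mono) auto
    also have "\<dots> \<le> dist_C01 u v"
      using dist_C01_upper[OF uv t] by simp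
    finally show "\<bar>?T u t - ?T v t\<bar> \<le> dist_C01 u v" .
  qed (use TC uv in auto)
  show ?thesis
    unfolding borel_C01_def
  proof (rule measurable_measure_of)
    show "?T \<in> space (sigma C01 {U. openin mtopology U}) \<rightarrow> C01"
      using TC by (auto simp flip: borel_C01_def)
    fix U assume "U \<in> {U. openin mtopology U}"
    then have U: "openin mtopology U" by simp
    have "openin mtopology (?T -` U \<inter> C01)"
      unfolding openin_mtopology
    proof safe
      fix w assume w: "w \<in> C01" "?T w \<in> U"
      obtain e where e: "e > 0" "mball (?T w) e \<subseteq> U"
        using U w(2) unfolding openin_mtopology by auto
      have "mball w e \<subseteq> ?T -` U \<inter> C01"
      proof
        fix v assume "v \<in> mball w e"
        then have v: "v \<in> C01" "dist_C01 w v < e" by auto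
        then have "?T v \<in> mball (?T w) e"
          using lip[OF w(1) v(1)] TC w(1) by auto
        then show "v \<in> ?T -` U \<inter> C01" using e v by auto
      qed
      with e(1) show "\<exists>r>0. mball w r \<subseteq> ?T -` U \<inter> C01" by blast
    qed
    then show "?T -` U \<inter> space (sigma C01 {U. openin mtopology U}) \<in> sets (sigma C01 {U. openin mtopology U})"
      by (auto simp: sets_borel_C01 simp flip: borel_C01_def)
  qed (auto dest!: openin_subset)
qed

lemma prob_space_white_noise_law:
  assumes W: "wiener_measure W" and f: "f \<in> densities01" and n: "n \<ge> 1"
  shows "prob_space (white_noise_law W n f)"
proof -
  have sets: "sets W = sets borel_C01" and P: "prob_space W"
    using W by (auto simp: wiener_measure_def standard_brownian_motion_def)
  have "white_noise_path n f \<in> measurable W borel_C01"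
    using measurable_white_noise_path[OF f n] measurable_cong_sets[OF sets refl] by blast
  with P show ?thesis
    unfolding white_noise_law_def by (rule prob_space.prob_space_distr)
qed


section \<open>Total variation and deficiency\<close>

text \<open>
  Half the \<open>L\<^sup>1\<close> distance of the densities with respect to the dominating measure \<open>P + Q\<close>;
  any other dominating measure gives the same value, see \<open>tv_dist_density\<close> below.
\<close>

definition measure_plus :: "'a measure \<Rightarrow> 'a measure \<Rightarrow> 'a measure" where
  "measure_plus P Q = measure_of (space P) (sets P) (\<lambda>A. emeasure P A + emeasure Q A)"

definition tv_dist :: "'a measure \<Rightarrow> 'a measure \<Rightarrow> ennreal" where
  "tv_dist P Q =
     (\<integral>\<^sup>+x. ennreal \<bar>enn2real (RN_deriv (measure_plus P Q) P x)
                   - enn2real (RN_deriv (measure_plus P Q) Q x)\<bar> \<partial>measure_plus P Q) / 2"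

lemma measure_plus_density:
  assumes [measurable]: "p \<in> borel_measurable \<nu>" "q \<in> borel_measurable \<nu>"
  shows "measure_plus (density \<nu> p) (density \<nu> q) = density \<nu> (\<lambda>x. p x + q x)"
proof -
  have "measure_plus (density \<nu> p) (density \<nu> q)
      = measure_of (space \<nu>) (sets \<nu>) (emeasure (density \<nu> (\<lambda>x. p x + q x)))"
    unfolding measure_plus_def space_density sets_density
    by (intro measure_of_eq)
      (auto simp: sets.space_closed sets.sigma_sets_eq emeasure_density distrib_right nn_integral_add)
  also have "\<dots> = density \<nu> (\<lambda>x. p x + q x)"
    using measure_of_of_measure[of "density \<nu> (\<lambda>x. p x + q x)"] by simp
  finally show ?thesis .
qed

lemma tv_dist_density:
  fixes p q :: "'a \<Rightarrow> real"
  assumes [measurable]: "p \<in> borel_measurable \<nu>" "q \<in> borel_measurable \<nu>"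
    and nn: "\<And>x. x \<in> space \<nu> \<Longrightarrow> 0 \<le> p x" "\<And>x. x \<in> space \<nu> \<Longrightarrow> 0 \<le> q x"
    and P: "prob_space (density \<nu> p)" and Q: "prob_space (density \<nu> q)"
  shows "tv_dist (density \<nu> p) (density \<nu> q) = (\<integral>\<^sup>+x. ennreal \<bar>p x - q x\<bar> \<partial>\<nu>) / 2"
proof -
  define \<mu> where "\<mu> = density \<nu> (\<lambda>x. ennreal (p x) + ennreal (q x))"
  have \<mu>: "measure_plus (density \<nu> p) (density \<nu> q) = \<mu>"
    unfolding \<mu>_def by (rule measure_plus_density) auto
  have "emeasure \<mu> (space \<mu>) = emeasure (density \<nu> p) (space (density \<nu> p))
      + emeasure (density \<nu> q) (space (density \<nu> q))"
    by (simp add: \<mu>_def emeasure_density nn_integral_add distrib_right)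
  then have "emeasure \<mu> (space \<mu>) = 1 + 1"
    by (simp only: prob_space.emeasure_space_1[OF P] prob_space.emeasure_space_1[OF Q])
  then interpret finite_measure \<mu>
    by (intro finite_measureI) simp
  have RN: "AE x in \<mu>. ennreal (r x / (p x + q x)) = RN_deriv \<mu> (density \<nu> r) x"
    if [measurable]: "r \<in> borel_measurable \<nu>" and r: "r = p \<or> r = q" for r
  proof (rule RN_deriv_unique)
    show "(\<lambda>x. ennreal (r x / (p x + q x))) \<in> borel_measurable \<mu>"
      unfolding \<mu>_def by simp
    have "density \<mu> (\<lambda>x. ennreal (r x / (p x + q x)))
        = density \<nu> (\<lambda>x. (ennreal (p x) + ennreal (q x)) * ennreal (r x / (p x + q x)))"
      unfolding \<mu>_def by (rule density_density_eq) auto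
    also have "\<dots> = density \<nu> r"
    proof (intro density_cong AE_I2)
      fix x assume x: "x \<in> space \<nu>"
      have "(p x + q x) * (r x / (p x + q x)) = r x"
        using nn[OF x] r by (cases "p x + q x = 0") (auto simp: add_nonneg_eq_0_iff)
      then show "(ennreal (p x) + ennreal (q x)) * ennreal (r x / (p x + q x)) = ennreal (r x)"
        using nn[OF x] r by (auto simp flip: ennreal_plus ennreal_mult)
    qed auto
    finally show "density \<mu> (\<lambda>x. ennreal (r x / (p x + q x))) = density \<nu> r" .
  qed
  have "(\<integral>\<^sup>+x. ennreal \<bar>enn2real (RN_deriv \<mu> (density \<nu> p) x)
           - enn2real (RN_deriv \<mu> (density \<nu> q) x)\<bar> \<partial>\<mu>)
      = (\<integral>\<^sup>+x. ennreal \<bar>p x / (p x + q x) - q x / (p x + q x)\<bar> \<partial>\<mu>)"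
  proof (rule nn_integral_cong_AE)
    have "AE x in \<mu>. x \<in> space \<nu>"
      by (auto simp: \<mu>_def intro!: AE_I2)
    moreover have "AE x in \<mu>. ennreal (p x / (p x + q x)) = RN_deriv \<mu> (density \<nu> p) x"
      by (rule RN) auto
    moreover have "AE x in \<mu>. ennreal (q x / (p x + q x)) = RN_deriv \<mu> (density \<nu> q) x"
      by (rule RN) auto
    ultimately show "AE x in \<mu>. ennreal \<bar>enn2real (RN_deriv \<mu> (density \<nu> p) x)
           - enn2real (RN_deriv \<mu> (density \<nu> q) x)\<bar>
         = ennreal \<bar>p x / (p x + q x) - q x / (p x + q x)\<bar>"
    proof eventually_elim
      case (elim x)
      show ?case
        unfolding elim(2,3)[symmetric] using nn[OF elim(1)] by simp
    qed
  qed
  also have "\<dots> = (\<integral>\<^sup>+x. (ennreal (p x) + ennreal (q x))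
      * ennreal \<bar>p x / (p x + q x) - q x / (p x + q x)\<bar> \<partial>\<nu>)"
    unfolding \<mu>_def by (rule nn_integral_density) auto
  also have "\<dots> = (\<integral>\<^sup>+x. ennreal \<bar>p x - q x\<bar> \<partial>\<nu>)"
  proof (rule nn_integral_cong)
    fix x assume x: "x \<in> space \<nu>"
    have "(p x + q x) * \<bar>p x / (p x + q x) - q x / (p x + q x)\<bar> = \<bar>p x - q x\<bar>"
      using nn[OF x]
      by (cases "p x + q x = 0") (auto simp: add_nonneg_eq_0_iff simp flip: diff_divide_distrib)
    then show "(ennreal (p x) + ennreal (q x)) * ennreal \<bar>p x / (p x + q x) - q x / (p x + q x)\<bar>
        = ennreal \<bar>p x - q x\<bar>"
      using nn[OF x] by (auto simp flip: ennreal_plus ennreal_mult)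
  qed
  finally show ?thesis
    by (simp add: tv_dist_def \<mu>)
qed

text \<open>
  The deficiency of \<open>(S, P)\<close> with respect to \<open>(T, Q)\<close>, where \<open>S\<close>, \<open>T\<close> are the sample spaces (only
  their measurable structure is used). A Markov kernel is a measurable map into
  \<^term>\<open>prob_algebra T\<close>, and \<^term>\<open>bind (P \<theta>) K\<close> is the image of \<open>P \<theta>\<close> under \<open>K\<close>.
\<close>

definition deficiency ::
    "'p set \<Rightarrow> 'a measure \<Rightarrow> ('p \<Rightarrow> 'a measure) \<Rightarrow> 'b measure \<Rightarrow> ('p \<Rightarrow> 'b measure) \<Rightarrow> ennreal" where
  "deficiency \<Theta> S P T Q =
     (INF K \<in> measurable S (prob_algebra T). SUP \<theta>\<in>\<Theta>. tv_dist (bind (P \<theta>) K) (Q \<theta>))"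

end

theory Submission
  imports Defs
begin

text \<open>
  Two-point argument. A density \<open>f\<close> with a flatness bound that attains the small value \<open>t\<close> at some
  point stays within 10 percent of \<open>t\<close> on a window of width of order \<open>(t / R) powr (1 / \<beta>)\<close>, and at
  the critical level \<open>t\<close> such a window carries on average only a bounded number of observations.
  Inside the window, compare \<open>f\<close> with \<open>g = f + t \<psi>((x - a) / h)\<close>, where \<open>\<psi>\<close> is a smooth dipole
  with values in \<open>[-3/4, 3/4]\<close>, and \<open>\<Lambda> = n t h\<close> is a small constant. In the density experiment the
  total variation distance of the product laws is at most a constant times \<open>\<Lambda>\<close>, by subadditivity.
  In the white noise experiment a single increment of \<open>Y\<close> over the negative half of the dipole is
  Gaussian and its mean shifts by an amount of order \<open>sqrt \<Lambda>\<close> standard deviations. For small \<open>\<Lambda>\<close>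
  the second effect dominates, so no kernel can transport both density laws close to the white
  noise laws.
\<close>

section \<open>Total variation and deficiency\<close>

text \<open>The infimum of \<open>f\<close> may be 0, where no relative perturbation is possible, so
  the point of attack is not a minimiser but a point where \<open>f\<close> equals t exactly; the
  hypothesis on the infimum and the unit integral supply it through intermediate values. The width h
  is a multiple of (t / R)^(1/\<beta>) because then t h^(-j) is a multiple of R^(j/\<beta>) t^(1 -
  j/\<beta>), which is what the flatness bound allows at level t. All factors depend on \<beta>
  alone, hence so does c. A dipole rather than a bump keeps the integral equal to 1. The constants:
  the product laws differ by at most 7.5 \<Lambda> (height 3t/4, width 10h), while the white noise
  mean moves by at least 7.2 sqrt(\<Lambda>/8) standard deviations over a stretch of length 8h. The
  choice \<Lambda> = 1/200 gives 0.0375 on one side and a shift of 0.18, worth probability 0.06, on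
  the other. The surplus 0.0225, shared between the two parameter values, exceeds twice
  0.007.\<close>

lemma
  assumes P: "finite_measure P" and Q: "finite_measure Q" and S: "sets P = sets Q"
  shows sets_measure_plus: "sets (measure_plus P Q) = sets P"
    and emeasure_measure_plus:
      "\<And>A. A \<in> sets P \<Longrightarrow> emeasure (measure_plus P Q) A = emeasure P A + emeasure Q A"
proof -
  show *: "sets (measure_plus P Q) = sets P"
    unfolding measure_plus_def by (simp add: sets.space_closed sets.sigma_sets_eq)
  fix A assume A: "A \<in> sets P"
  have "countably_additive (sets P) (\<lambda>A. emeasure P A + emeasure Q A)"
    unfolding countably_additive_def
    by (auto simp: S suminf_emeasure suminf_add[symmetric])
  then show "emeasure (measure_plus P Q) A = emeasure P A + emeasure Q A"
    using A * unfolding measure_plus_def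
    by (intro emeasure_measure_of[where \<Omega>="space P" and A="sets P"])
       (auto simp: sets.space_closed positive_def)
qed

text \<open>The difference of P A and Q A is bounded by the integral of |p - q| over A and, passing
  to complements, also by the integral over the complement of A. Averaging the two bounds produces
  the factor 1/2 in \<open>tv_dist\<close>.\<close>

lemma tv_dist_ge:
  assumes P: "prob_space P" and Q: "prob_space Q" and S: "sets P = sets Q" and A: "A \<in> sets P"
  shows "ennreal \<bar>measure P A - measure Q A\<bar> \<le> tv_dist P Q"
proof -
  interpret P: prob_space P by (rule P)
  interpret Q: prob_space Q by (rule Q)
  define \<mu> where "\<mu> = measure_plus P Q"
  note fm = P.finite_measure_axioms Q.finite_measure_axioms S
  have [simp, measurable_cong]: "sets \<mu> = sets P" and "sets \<mu> = sets Q"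
    using sets_measure_plus[OF fm] S by (auto simp: \<mu>_def)
  have em: "emeasure \<mu> B = emeasure P B + emeasure Q B" if "B \<in> sets P" for B
    using emeasure_measure_plus[OF fm that] by (simp add: \<mu>_def)
  have "space \<mu> = space P"
    by (intro sets_eq_imp_space_eq) simp
  then interpret finite_measure \<mu>
    using em[OF sets.top] P.emeasure_space_1 Q.emeasure_space_1 sets_eq_imp_space_eq[OF S]
    by (intro finite_measureI) simp
  have ac: "absolutely_continuous \<mu> P" "absolutely_continuous \<mu> Q"
    by (auto simp: absolutely_continuous_def null_sets_def em S)
  define p where "p x = enn2real (RN_deriv \<mu> P x)" for x
  define q where "q x = enn2real (RN_deriv \<mu> Q x)" for x
  have [measurable]: "p \<in> borel_measurable \<mu>" "q \<in> borel_measurable \<mu>"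
    unfolding p_def q_def by measurable
  \<comment> \<open>Probability measures are sigma-finite, so the Radon-Nikodym derivatives are
    finite almost everywhere and \<open>enn2real\<close> loses no mass.\<close>
  have "AE x in \<mu>. RN_deriv \<mu> P x \<noteq> \<infinity>"
    using RN_deriv_finite[OF P.sigma_finite_measure_axioms ac(1)] by simp
  then have "density \<mu> p = density \<mu> (RN_deriv \<mu> P)"
    by (intro density_cong) (auto simp: p_def top.not_eq_extremum)
  then have dp: "density \<mu> p = P"
    using density_RN_deriv[OF ac(1)] by simp
  have "AE x in \<mu>. RN_deriv \<mu> Q x \<noteq> \<infinity>"
    using RN_deriv_finite[OF Q.sigma_finite_measure_axioms ac(2)] S by simp
  then have "density \<mu> q = density \<mu> (RN_deriv \<mu> Q)"
    by (intro density_cong) (auto simp: q_def top.not_eq_extremum)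
  then have dq: "density \<mu> q = Q"
    using density_RN_deriv[OF ac(2)] S by simp
  let ?d = "\<lambda>x. ennreal \<bar>p x - q x\<bar>"
  have P_le: "emeasure P B \<le> emeasure Q B + (\<integral>\<^sup>+x\<in>B. ?d x \<partial>\<mu>)" if "B \<in> sets P" for B
  proof -
    have [measurable]: "B \<in> sets \<mu>" using that by simp
    have "emeasure P B = (\<integral>\<^sup>+x\<in>B. p x \<partial>\<mu>)"
      using that by (subst dp[symmetric]) (simp add: emeasure_density)
    also have "\<dots> \<le> (\<integral>\<^sup>+x. ennreal (q x) * indicator B x + ?d x * indicator B x \<partial>\<mu>)"
      by (intro nn_integral_mono) (auto simp: p_def q_def split: split_indicator simp flip: ennreal_plus)
    also have "\<dots> = (\<integral>\<^sup>+x\<in>B. q x \<partial>\<mu>) + (\<integral>\<^sup>+x\<in>B. ?d x \<partial>\<mu>)"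
      by (intro nn_integral_add) auto
    also have "(\<integral>\<^sup>+x\<in>B. q x \<partial>\<mu>) = emeasure Q B"
      using that by (subst dq[symmetric]) (simp add: emeasure_density)
    finally show ?thesis .
  qed
  have Q_le: "emeasure Q B \<le> emeasure P B + (\<integral>\<^sup>+x\<in>B. ?d x \<partial>\<mu>)" if "B \<in> sets P" for B
  proof -
    have [measurable]: "B \<in> sets \<mu>" using that by simp
    have "emeasure Q B = (\<integral>\<^sup>+x\<in>B. q x \<partial>\<mu>)"
      using that by (subst dq[symmetric]) (simp add: emeasure_density)
    also have "\<dots> \<le> (\<integral>\<^sup>+x. ennreal (p x) * indicator B x + ?d x * indicator B x \<partial>\<mu>)"
      by (intro nn_integral_mono) (auto simp: p_def q_def split: split_indicator simp flip: ennreal_plus)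
    also have "\<dots> = (\<integral>\<^sup>+x\<in>B. p x \<partial>\<mu>) + (\<integral>\<^sup>+x\<in>B. ?d x \<partial>\<mu>)"
      by (intro nn_integral_add) auto
    also have "(\<integral>\<^sup>+x\<in>B. p x \<partial>\<mu>) = emeasure P B"
      using that by (subst dp[symmetric]) (simp add: emeasure_density)
    finally show ?thesis .
  qed
  let ?D = "\<integral>\<^sup>+x. ?d x \<partial>\<mu>"
  have tv: "tv_dist P Q = ?D / 2"
    by (simp add: tv_dist_def \<mu>_def p_def q_def)
  let ?C = "space P - A"
  have split: "(\<integral>\<^sup>+x\<in>A. ?d x \<partial>\<mu>) + (\<integral>\<^sup>+x\<in>?C. ?d x \<partial>\<mu>) = ?D"
    using A \<open>space \<mu> = space P\<close>
    by (subst nn_integral_add[symmetric])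
       (auto intro!: nn_integral_cong split: split_indicator)
  show ?thesis
  proof (cases "?D = \<infinity>")
    case True
    then show ?thesis by (simp add: tv ennreal_top_divide)
  next
    case False
    define a where "a = enn2real (\<integral>\<^sup>+x\<in>A. ?d x \<partial>\<mu>)"
    define b where "b = enn2real (\<integral>\<^sup>+x\<in>?C. ?d x \<partial>\<mu>)"
    have a: "(\<integral>\<^sup>+x\<in>A. ?d x \<partial>\<mu>) = ennreal a" "0 \<le> a" and b: "(\<integral>\<^sup>+x\<in>?C. ?d x \<partial>\<mu>) = ennreal b" "0 \<le> b"
      using split False unfolding a_def b_def by (auto simp: ennreal_enn2real_if)
    have "measure P A \<le> measure Q A + a" "measure Q A \<le> measure P A + a"
      using P_le[OF A] Q_le[OF A] a(2) unfolding a(1) P.emeasure_eq_measure Q.emeasure_eq_measure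
      by (auto simp flip: ennreal_plus)
    moreover have C: "?C \<in> sets P" using A by auto
    have "measure P ?C \<le> measure Q ?C + b" "measure Q ?C \<le> measure P ?C + b"
      using P_le[OF C] Q_le[OF C] b(2) unfolding b(1) P.emeasure_eq_measure Q.emeasure_eq_measure
      by (auto simp flip: ennreal_plus)
    moreover have "measure P ?C = 1 - measure P A" "measure Q ?C = 1 - measure Q A"
      using P.prob_compl[OF A] Q.prob_compl[of A] A S sets_eq_imp_space_eq[OF S] by auto
    ultimately have "\<bar>measure P A - measure Q A\<bar> \<le> a" "\<bar>measure P A - measure Q A\<bar> \<le> b"
      by linarith+
    then have "\<bar>measure P A - measure Q A\<bar> \<le> (a + b) / 2"
      by (simp add: field_simps)
    then have "ennreal \<bar>measure P A - measure Q A\<bar> \<le> ennreal ((a + b) / 2)"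
      by (rule ennreal_leI)
    also have "\<dots> = ?D / 2"
      unfolding split[symmetric] a b using a(2) b(2)
      by (simp flip: ennreal_plus add: divide_ennreal[symmetric])
    finally show ?thesis by (simp add: tv)
  qed
qed

section \<open>Product laws compared through their marginals\<close>

abbreviation unit_density :: "(real \<Rightarrow> real) \<Rightarrow> real measure" where
  "unit_density f \<equiv> density (restrict_space lborel {0..1}) (\<lambda>x. ennreal (f x))"

lemma densities01_measurable:
  assumes "f \<in> densities01"
  shows "f \<in> borel_measurable (restrict_space lborel {0..1})"
  using assms
  by (subst measurable_cong_sets[of _ "restrict_space borel {0..1}" borel borel])
    (auto simp: densities01_def sets_restrict_space)

lemma prob_space_unit_density:
  assumes f: "f \<in> densities01"
  shows "prob_space (unit_density f)"
proof (rule prob_spaceI)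
  note m [measurable] = densities01_measurable[OF f]
  have "emeasure (unit_density f) (space (unit_density f)) = (\<integral>\<^sup>+x. f x \<partial>restrict_space lborel {0..1})"
    by (subst emeasure_density)
      (use m in \<open>auto simp: space_restrict_space sets_restrict_space intro!: nn_integral_cong\<close>)
  also have "\<dots> = (\<integral>\<^sup>+x. ennreal (indicator {0..1} x *\<^sub>R f x) \<partial>lborel)"
    by (auto simp: nn_integral_restrict_space split: split_indicator intro!: nn_integral_cong)
  also have "\<dots> = ennreal (LBINT x:{0..1}. f x)"
    unfolding set_lebesgue_integral_def
    using f densities01_integrable[OF f]
    by (intro nn_integral_eq_integral)
      (auto simp: densities01_def set_integrable_def split: split_indicator)
  also have "\<dots> = 1"
    using f by (simp add: densities01_def)
  finally show "emeasure (unit_density f) (space (unit_density f)) = 1" .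
qed

text \<open>Since \<open>ennreal\<close> sends negative reals to 0, the last integral is that of the
  positive part of f - g, which is the total variation distance. A test function with values in
  [0,1] replaces an event because kernels and partial integrals produce such functions.\<close>

lemma unit_density_le:
  assumes f: "f \<in> densities01" and g: "g \<in> densities01"
    and \<phi> [measurable]: "\<phi> \<in> borel_measurable (restrict_space borel {0..1})"
    and le: "\<And>x. x \<in> {0..1} \<Longrightarrow> \<phi> x \<le> (1::ennreal)"
  shows "(\<integral>\<^sup>+x. \<phi> x \<partial>unit_density f)
    \<le> (\<integral>\<^sup>+x. \<phi> x \<partial>unit_density g) + (\<integral>\<^sup>+x\<in>{0..1}. ennreal (f x - g x) \<partial>lborel)"
proof -
  let ?L = "restrict_space lborel {0..1::real}"
  note [measurable] = densities01_measurable[OF f] densities01_measurable[OF g]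
  have [measurable]: "\<phi> \<in> borel_measurable ?L"
    using \<phi> by (subst measurable_cong_sets[of _ "restrict_space borel {0..1}" borel borel])
      (auto simp: sets_restrict_space)
  have "(\<integral>\<^sup>+x. \<phi> x \<partial>unit_density f) = (\<integral>\<^sup>+x. f x * \<phi> x \<partial>?L)"
    by (subst nn_integral_density) auto
  also have "\<dots> \<le> (\<integral>\<^sup>+x. g x * \<phi> x + ennreal (f x - g x) \<partial>?L)"
  proof (rule nn_integral_mono)
    fix x assume "x \<in> space ?L"
    then have x: "x \<in> {0..1}" by (simp add: space_restrict_space)
    then have "ennreal (f x) \<le> ennreal (g x) + ennreal (f x - g x)"
      using g by (cases "f x \<ge> g x") (auto simp: densities01_def ennreal_neg simp flip: ennreal_plus intro: ennreal_leI)
    then have "ennreal (f x) * \<phi> x \<le> (ennreal (g x) + ennreal (f x - g x)) * \<phi> x"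
      by (rule mult_right_mono) simp
    also have "\<dots> \<le> ennreal (g x) * \<phi> x + ennreal (f x - g x) * 1"
      unfolding distrib_right by (intro add_left_mono mult_left_mono le x) auto
    finally show "ennreal (f x) * \<phi> x \<le> ennreal (g x) * \<phi> x + ennreal (f x - g x)" by simp
  qed
  also have "\<dots> = (\<integral>\<^sup>+x. g x * \<phi> x \<partial>?L) + (\<integral>\<^sup>+x. ennreal (f x - g x) \<partial>?L)"
    by (rule nn_integral_add) auto
  also have "(\<integral>\<^sup>+x. g x * \<phi> x \<partial>?L) = (\<integral>\<^sup>+x. \<phi> x \<partial>unit_density g)"
    by (subst nn_integral_density) auto
  finally show ?thesis by (simp add: nn_integral_restrict_space)
qed

text \<open>Induction replacing one factor of the product at a time.\<close>

lemma iid_law_le: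
  assumes f: "f \<in> densities01" and g: "g \<in> densities01"
    and "\<phi> \<in> borel_measurable (iid_space n)"
    and "\<And>\<omega>. \<omega> \<in> space (iid_space n) \<Longrightarrow> \<phi> \<omega> \<le> (1::ennreal)"
  shows "(\<integral>\<^sup>+\<omega>. \<phi> \<omega> \<partial>iid_law n f)
    \<le> (\<integral>\<^sup>+\<omega>. \<phi> \<omega> \<partial>iid_law n g) + of_nat n * (\<integral>\<^sup>+x\<in>{0..1}. ennreal (f x - g x) \<partial>lborel)"
  using assms(3,4)
proof (induction n arbitrary: \<phi>)
  case 0
  then show ?case
    by (simp add: iid_law_def PiM_empty)
next
  case (Suc n)
  let ?d = "\<integral>\<^sup>+x\<in>{0..1}. ennreal (f x - g x) \<partial>lborel"
  interpret Pf: prob_space "unit_density f" by (rule prob_space_unit_density[OF f])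
  interpret Pg: prob_space "unit_density g" by (rule prob_space_unit_density[OF g])
  interpret F: product_sigma_finite "\<lambda>_::nat. unit_density f" by standard
  interpret G: product_sigma_finite "\<lambda>_::nat. unit_density g" by standard
  interpret Fn: prob_space "iid_law n f" by (rule prob_space_iid_law[OF f])
  note \<phi> [measurable] = Suc.prems(1)
  have "(\<lambda>(\<omega>, y). (fun_upd \<omega> n y)) \<in> iid_space n \<Otimes>\<^sub>M restrict_space borel {0..1} \<rightarrow>\<^sub>M iid_space (Suc n)"
    unfolding iid_space_def lessThan_Suc by (rule measurable_add_dim)
  then have m: "(\<lambda>(\<omega>, y). \<phi> ((fun_upd \<omega> n y))) \<in> borel_measurable (iid_space n \<Otimes>\<^sub>M restrict_space borel {0..1})"
    using measurable_compose[OF _ \<phi>] by (simp add: case_prod_beta')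
  have cong: "measurable (iid_law n h \<Otimes>\<^sub>M unit_density h') borel
      = measurable (iid_space n \<Otimes>\<^sub>M restrict_space borel {0..1}) (borel :: ennreal measure)" for h h'
    by (intro measurable_cong_sets sets_pair_measure_cong) (auto simp: sets_restrict_space)
  have cong1: "measurable (iid_law k h) borel
      = measurable (iid_space k) (borel :: ennreal measure)" for k h
    by (intro measurable_cong_sets) auto
  \<comment> \<open>The last coordinate is integrated out under \<open>g\<close>; the result still
    takes values in [0,1], so the induction hypothesis applies to it.\<close>
  define \<psi> where "\<psi> \<omega> = (\<integral>\<^sup>+y. \<phi> ((fun_upd \<omega> n y)) \<partial>unit_density g)" for \<omega>
  have "\<psi> \<in> borel_measurable (iid_law n g)"
    unfolding \<psi>_def using m by (intro Pg.borel_measurable_nn_integral) (simp add: cong)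
  then have \<psi>: "\<psi> \<in> borel_measurable (iid_space n)" by (simp add: cong1)
  have upd: "(fun_upd \<omega> n y) \<in> space (iid_space (Suc n))" if "\<omega> \<in> space (iid_space n)" "y \<in> {0..1}" for \<omega> y
    using that by (auto simp: iid_space_def space_PiM PiE_iff extensional_def space_restrict_space less_Suc_eq)
  have \<psi>1: "\<psi> \<omega> \<le> 1" if "\<omega> \<in> space (iid_space n)" for \<omega>
  proof -
    have "\<psi> \<omega> \<le> (\<integral>\<^sup>+y. 1 \<partial>unit_density g)"
      unfolding \<psi>_def using Suc.prems(2) upd that
      by (intro nn_integral_mono) (auto simp: space_restrict_space)
    then show ?thesis by (simp add: Pg.emeasure_space_1[simplified])
  qed
  have spc: "space (iid_law n f) = space (iid_space n)"
    by (intro sets_eq_imp_space_eq) simp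
  have "(\<integral>\<^sup>+\<omega>. \<phi> \<omega> \<partial>iid_law (Suc n) f) = (\<integral>\<^sup>+\<omega>. (\<integral>\<^sup>+y. \<phi> ((fun_upd \<omega> n y)) \<partial>unit_density f) \<partial>iid_law n f)"
    using \<phi> cong1[of "Suc n" f] unfolding iid_law_def lessThan_Suc
    by (intro F.product_nn_integral_insert) auto
  also have "\<dots> \<le> (\<integral>\<^sup>+\<omega>. \<psi> \<omega> + ?d \<partial>iid_law n f)"
    unfolding \<psi>_def
  proof (intro nn_integral_mono unit_density_le f g)
    fix \<omega> assume \<omega>: "\<omega> \<in> space (iid_law n f)"
    then show "(\<lambda>y. \<phi> ((fun_upd \<omega> n y))) \<in> borel_measurable (restrict_space borel {0..1})"
      using measurable_Pair2[OF m, of \<omega>] by (simp add: spc)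
    show "\<phi> ((fun_upd \<omega> n y)) \<le> 1" if "y \<in> {0..1}" for y
      by (intro Suc.prems(2) upd) (use \<omega> that in \<open>simp_all add: spc\<close>)
  qed
  also have "\<dots> = (\<integral>\<^sup>+\<omega>. \<psi> \<omega> \<partial>iid_law n f) + ?d"
    using \<psi> by (subst nn_integral_add) (auto simp: cong1 Fn.emeasure_space_1)
  also have "\<dots> \<le> (\<integral>\<^sup>+\<omega>. \<psi> \<omega> \<partial>iid_law n g) + of_nat n * ?d + ?d"
    by (intro add_right_mono Suc.IH \<psi> \<psi>1)
  also have "(\<integral>\<^sup>+\<omega>. \<psi> \<omega> \<partial>iid_law n g) = (\<integral>\<^sup>+\<omega>. \<phi> \<omega> \<partial>iid_law (Suc n) g)"
    using \<phi> cong1[of "Suc n" g] unfolding iid_law_def lessThan_Suc \<psi>_def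
    by (intro G.product_nn_integral_insert[symmetric]) auto
  finally show ?case by (simp add: algebra_simps)
qed

text \<open>Le Cam's two-point argument. The kernel probability of A is a [0,1]-valued function of
  the data, so its mean under \<open>g\<close> exceeds that under \<open>f\<close> by at most r,
  while the target laws are at least r + 2 d apart on A. For one of the two parameters the error on
  A is therefore at least d, whatever the kernel.\<close>

lemma two_point_deficiency:
  fixes Q :: "(real \<Rightarrow> real) \<Rightarrow> 'b measure"
  assumes \<Theta>: "\<Theta> \<subseteq> densities01" and f: "f \<in> \<Theta>" and g: "g \<in> \<Theta>"
    and Q: "\<And>h. h \<in> \<Theta> \<Longrightarrow> prob_space (Q h)" "\<And>h. h \<in> \<Theta> \<Longrightarrow> sets (Q h) = sets T"
    and A: "A \<in> sets T"
    and L1: "of_nat n * (\<integral>\<^sup>+x\<in>{0..1}. ennreal (g x - f x) \<partial>lborel) \<le> ennreal r" and r: "0 \<le> r"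
    and gap: "r + 2 * d \<le> measure (Q g) A - measure (Q f) A"
  shows "ennreal d \<le> deficiency \<Theta> (iid_space n) (iid_law n) T Q"
  unfolding deficiency_def
proof (rule INF_greatest)
  fix K assume K: "K \<in> measurable (iid_space n) (prob_algebra T)"
  let ?S = "SUP h\<in>\<Theta>. tv_dist (bind (iid_law n h) K) (Q h)"
  let ?m = "\<lambda>h. measure (bind (iid_law n h) K) A"
  have P: "iid_law n h \<in> space (prob_algebra (iid_space n))" if "h \<in> \<Theta>" for h
    using that \<Theta> prob_space_iid_law by (auto simp: space_prob_algebra)
  have pb: "prob_space (bind (iid_law n h) K)" if "h \<in> \<Theta>" for h
    by (rule prob_space_bind'[OF P[OF that] K])
  have sb: "sets (bind (iid_law n h) K) = sets T" if "h \<in> \<Theta>" for h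
    by (rule sets_bind'[OF P[OF that] K])
  have tv: "ennreal \<bar>?m h - measure (Q h) A\<bar> \<le> ?S" if h: "h \<in> \<Theta>" for h
    using A sb[OF h] Q(2)[OF h]
    by (intro order_trans[OF _ SUP_upper[OF h]] tv_dist_ge pb h Q(1)) simp_all
  have em: "emeasure (bind (iid_law n h) K) A = (\<integral>\<^sup>+\<omega>. emeasure (K \<omega>) A \<partial>iid_law n h)" if "h \<in> \<Theta>" for h
    by (rule emeasure_bind_prob_algebra[OF P[OF that] K A])
  have "(\<integral>\<^sup>+\<omega>. emeasure (K \<omega>) A \<partial>iid_law n g)
      \<le> (\<integral>\<^sup>+\<omega>. emeasure (K \<omega>) A \<partial>iid_law n f) + of_nat n * (\<integral>\<^sup>+x\<in>{0..1}. ennreal (g x - f x) \<partial>lborel)"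
  proof (rule iid_law_le)
    show "(\<lambda>\<omega>. emeasure (K \<omega>) A) \<in> borel_measurable (iid_space n)"
      using measurable_compose[OF measurable_prob_algebraD[OF K] measurable_emeasure_subprob_algebra[OF A]] .
    fix \<omega> assume "\<omega> \<in> space (iid_space n)"
    then have "prob_space (K \<omega>)"
      using measurable_space[OF K] by (simp add: space_prob_algebra)
    then show "emeasure (K \<omega>) A \<le> 1"
      by (rule prob_space.measure_le_1)
  qed (use \<Theta> f g in auto)
  also have "\<dots> \<le> (\<integral>\<^sup>+\<omega>. emeasure (K \<omega>) A \<partial>iid_law n f) + ennreal r"
    by (intro add_left_mono L1)
  finally have "emeasure (bind (iid_law n g) K) A \<le> emeasure (bind (iid_law n f) K) A + ennreal r"
    by (simp add: em f g)
  then have "ennreal (?m g) \<le> ennreal (?m f) + ennreal r"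
    using prob_space.finite_measure[OF pb[OF f]] prob_space.finite_measure[OF pb[OF g]]
    by (simp add: finite_measure.emeasure_eq_measure)
  then have "?m g \<le> ?m f + r"
    using r by (simp flip: ennreal_plus)
  then have "2 * d \<le> \<bar>?m g - measure (Q g) A\<bar> + \<bar>?m f - measure (Q f) A\<bar>"
    using gap by linarith
  then have "d \<le> \<bar>?m g - measure (Q g) A\<bar> \<or> d \<le> \<bar>?m f - measure (Q f) A\<bar>"
    by linarith
  then show "ennreal d \<le> ?S"
    using tv[OF f] tv[OF g] by (meson ennreal_leI order_trans)
qed

section \<open>An increment of the white noise\<close>

text \<open>The interval has length 0.18 \<sigma> and the density there is at least 1 / (3
  \<sigma>): the exponential is at least 1 - 81/20000, and pi < 4 gives sqrt (2 pi) <= 2.9.\<close>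

lemma normal_density_central_mass:
  assumes s: "0 < \<sigma>"
  shows "ennreal 0.06 \<le> (\<integral>\<^sup>+x. ennreal (normal_density 0 \<sigma> x) * indicator {- (0.09 * \<sigma>)..<0.09 * \<sigma>} x \<partial>lborel)"
proof -
  let ?I = "{- (0.09 * \<sigma>)..<0.09 * \<sigma>}"
  have lower: "1 / (3 * \<sigma>) \<le> normal_density 0 \<sigma> x" if "x \<in> ?I" for x
  proof -
    have "x\<^sup>2 \<le> (0.09 * \<sigma>)\<^sup>2"
      using that by (intro abs_le_square_iff[THEN iffD1]) auto
    then have "x\<^sup>2 / (2 * \<sigma>\<^sup>2) \<le> 81 / 20000"
      using s by (simp add: field_simps power2_eq_square)
    then have "199 / 200 \<le> exp (- (x\<^sup>2 / (2 * \<sigma>\<^sup>2)))"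
      using exp_ge_add_one_self[of "- (x\<^sup>2 / (2 * \<sigma>\<^sup>2))"] by linarith
    moreover have "sqrt (2 * pi * \<sigma>\<^sup>2) \<le> 2.9 * \<sigma>"
      using pi_less_4 s by (intro real_le_lsqrt) (auto simp: power2_eq_square)
    ultimately have "1 / (2.9 * \<sigma>) * (199 / 200) \<le> 1 / sqrt (2 * pi * \<sigma>\<^sup>2) * exp (- (x\<^sup>2 / (2 * \<sigma>\<^sup>2)))"
      using s by (intro mult_mono divide_left_mono) auto
    moreover have "1 / (3 * \<sigma>) \<le> 1 / (2.9 * \<sigma>) * (199 / 200)"
      using s by (simp add: field_simps)
    ultimately show ?thesis by (simp add: normal_density_def)
  qed
  have "ennreal 0.06 = ennreal (1 / (3 * \<sigma>)) * emeasure lborel ?I"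
    using s by (simp flip: ennreal_mult)
  also have "\<dots> = (\<integral>\<^sup>+x. ennreal (1 / (3 * \<sigma>)) * indicator ?I x \<partial>lborel)"
    by (simp add: nn_integral_cmult_indicator)
  also have "\<dots> \<le> (\<integral>\<^sup>+x. ennreal (normal_density 0 \<sigma> x) * indicator ?I x \<partial>lborel)"
    using lower by (intro nn_integral_mono) (auto split: split_indicator intro!: ennreal_leI)
  finally show ?thesis .
qed

text \<open>Under \<open>h\<close> the increment of Y over [l, m] is Gaussian with mean
  \<open>D h\<close> and standard deviation sqrt (m - l) / sqrt n. The separating event cuts 0.09
  standard deviations above the smaller mean \<open>D g\<close>, and \<open>D f\<close> lies at
  least 0.18 above \<open>D g\<close>. In terms of the Brownian increment, the thresholds under
  \<open>f\<close> and \<open>g\<close> then enclose the central interval of mass at least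
  0.06.\<close>

lemma white_noise_gap:
  fixes f g :: "real \<Rightarrow> real" and l m :: real
  defines "D \<equiv> \<lambda>h. 2 * (LBINT s:{0..m}. sqrt (h s)) - 2 * (LBINT s:{0..l}. sqrt (h s))"
  assumes W: "wiener_measure W" and n: "1 \<le> n" and f: "f \<in> densities01" and g: "g \<in> densities01"
    and lm: "0 \<le> l" "l < m" "m \<le> 1"
    and D: "0.18 * sqrt (m - l) / sqrt (real n) \<le> D f - D g"
  shows "\<exists>A\<in>sets borel_C01. 0.06 \<le> measure (white_noise_law W n g) A - measure (white_noise_law W n f) A"
proof -
  define \<sigma> where "\<sigma> = sqrt (m - l)"
  have \<sigma>: "0 < \<sigma>" using lm by (simp add: \<sigma>_def)
  have setsW: "sets W = sets borel_C01" and bm: "standard_brownian_motion W (\<lambda>t w. w t)"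
    using W by (auto simp: wiener_measure_def)
  have spW: "space W = C01" using sets_eq_imp_space_eq[OF setsW] by simp
  interpret prob_space W using bm by (simp add: standard_brownian_motion_def)
  define X where "X w = w m - w l" for w :: "real \<Rightarrow> real"
  have dist: "distributed W lborel X (\<lambda>x. ennreal (normal_density 0 \<sigma> x))"
    using bm lm unfolding standard_brownian_motion_def X_def \<sigma>_def by blast
  have X: "X \<in> borel_measurable borel_C01"
    unfolding X_def using lm by (intro borel_measurable_diff measurable_eval_C01) auto
  have XW: "X \<in> borel_measurable W"
    using X measurable_cong_sets[OF setsW refl] by blast
  have sqn: "0 < sqrt (real n)" using n by simp
  define A where "A = {w \<in> C01. X w < D g + 0.09 * \<sigma> / sqrt (real n)}"
  have A: "A \<in> sets borel_C01"
    using borel_measurable_less[OF X, of "\<lambda>_. D g + 0.09 * \<sigma> / sqrt (real n)"] by (simp add: A_def)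
  define U where "U y = {w \<in> C01. X w < y}" for y
  have U: "U y \<in> sets W" for y
    using borel_measurable_less[OF XW, of "\<lambda>_. y"] by (simp add: U_def spW)
  have law: "measure (white_noise_law W n h) A = measure W (U (sqrt (real n) * (D g - D h) + 0.09 * \<sigma>))"
    if h: "h \<in> densities01" for h
  proof -
    have meas: "white_noise_path n h \<in> measurable W borel_C01"
      using measurable_white_noise_path[OF h n] measurable_cong_sets[OF setsW refl] by blast
    have "X (white_noise_path n h w) = D h + X w / sqrt (real n)" for w
      using lm by (simp add: X_def D_def white_noise_path_def diff_divide_distrib)
    then have "white_noise_path n h -` A \<inter> space W
        = {w \<in> C01. D h + X w / sqrt (real n) < D g + 0.09 * \<sigma> / sqrt (real n)}"
      using white_noise_path_C01[OF h] by (auto simp: A_def spW)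
    also have "\<dots> = U (sqrt (real n) * (D g - D h) + 0.09 * \<sigma>)"
    proof -
      have "D h + x / sqrt (real n) < D g + 0.09 * \<sigma> / sqrt (real n)
          \<longleftrightarrow> (x - 0.09 * \<sigma>) / sqrt (real n) < D g - D h" for x
        by (auto simp: diff_divide_distrib)
      also have "\<dots> x \<longleftrightarrow> x < sqrt (real n) * (D g - D h) + 0.09 * \<sigma>" for x
        using sqn by (auto simp: pos_divide_less_eq mult.commute)
      finally show ?thesis by (auto simp: U_def)
    qed
    finally have "white_noise_path n h -` A \<inter> space W = U (sqrt (real n) * (D g - D h) + 0.09 * \<sigma>)" .
    then show ?thesis
      unfolding white_noise_law_def by (subst measure_distr[OF meas A]) simp
  qed
  let ?B = "{w \<in> C01. - (0.09 * \<sigma>) \<le> X w \<and> X w < 0.09 * \<sigma>}"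
  have B: "?B = X -` {- (0.09 * \<sigma>)..<0.09 * \<sigma>} \<inter> space W"
    by (auto simp: spW)
  have "ennreal 0.06 \<le> emeasure W ?B"
    unfolding B by (subst distributed_emeasure[OF dist]) (rule normal_density_central_mass[OF \<sigma>] | simp)+
  then have B6: "0.06 \<le> measure W ?B"
    by (simp add: emeasure_eq_measure)
  have Bm: "?B \<in> sets W" unfolding B by (rule measurable_sets[OF XW]) simp
  have "sqrt (real n) * (D g - D f) + 0.09 * \<sigma> \<le> - (0.09 * \<sigma>)"
    using D sqn by (simp add: \<sigma>_def field_simps)
  then have sub: "U (sqrt (real n) * (D g - D f) + 0.09 * \<sigma>) \<union> ?B \<subseteq> U (0.09 * \<sigma>)"
    and disj: "U (sqrt (real n) * (D g - D f) + 0.09 * \<sigma>) \<inter> ?B = {}"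
    using \<sigma> by (auto simp: U_def)
  have "measure W (U (sqrt (real n) * (D g - D f) + 0.09 * \<sigma>)) + measure W ?B \<le> measure W (U (0.09 * \<sigma>))"
    unfolding finite_measure_Union[OF U Bm disj, symmetric] by (rule finite_measure_mono[OF sub U])
  then have "0.06 \<le> measure (white_noise_law W n g) A - measure (white_noise_law W n f) A"
    using B6 by (simp add: law f g)
  then show ?thesis using A by blast
qed

section \<open>Smooth dipoles\<close>

text \<open>A function with its derivatives up to order k, and one common bound M for all values and
  Lipschitz constants. The Lipschitz bound at order k stands in for a derivative of order k + 1,
  which need not exist.\<close>

definition derivative_chain :: "nat \<Rightarrow> (nat \<Rightarrow> real \<Rightarrow> real) \<Rightarrow> real \<Rightarrow> bool" where
  "derivative_chain k D M \<longleftrightarrow>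
     (\<forall>j<k. \<forall>x. (D j has_real_derivative D (Suc j) x) (at x)) \<and>
     (\<forall>j\<le>k. \<forall>x. \<bar>D j x\<bar> \<le> M) \<and> (\<forall>j\<le>k. \<forall>x y. \<bar>D j x - D j y\<bar> \<le> M * \<bar>x - y\<bar>)"

lemma derivative_chain_nonneg:
  assumes "derivative_chain k D M"
  shows "0 \<le> M"
proof -
  have "\<bar>D 0 0\<bar> \<le> M"
    using assms by (auto simp: derivative_chain_def)
  then show ?thesis by linarith
qed

lemma derivative_chain_scale:
  assumes "derivative_chain k D M"
  shows "derivative_chain k (\<lambda>j x. c * D j x) (\<bar>c\<bar> * M)"
  unfolding derivative_chain_def
proof (intro conjI allI impI)
  fix j x y assume j: "j \<le> k"
  have "\<bar>D j x\<bar> \<le> M" "\<bar>D j x - D j y\<bar> \<le> M * \<bar>x - y\<bar>"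
    using assms j unfolding derivative_chain_def by blast+
  then show "\<bar>c * D j x\<bar> \<le> \<bar>c\<bar> * M" "\<bar>c * D j x - c * D j y\<bar> \<le> \<bar>c\<bar> * M * \<bar>x - y\<bar>"
    by (auto simp: abs_mult mult.assoc mult_left_mono simp flip: right_diff_distrib)
qed (use assms in \<open>auto simp: derivative_chain_def intro!: DERIV_cmult\<close>)

lemma derivative_chain_add:
  assumes "derivative_chain k D M" "derivative_chain k E N"
  shows "derivative_chain k (\<lambda>j x. D j x + E j x) (M + N)"
  unfolding derivative_chain_def
proof (intro conjI allI impI)
  fix j x y assume j: "j \<le> k"
  have "\<bar>D j x\<bar> \<le> M" "\<bar>D j x - D j y\<bar> \<le> M * \<bar>x - y\<bar>"
    using assms(1) j unfolding derivative_chain_def by blast+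
  moreover have "\<bar>E j x\<bar> \<le> N" "\<bar>E j x - E j y\<bar> \<le> N * \<bar>x - y\<bar>"
    using assms(2) j unfolding derivative_chain_def by blast+
  ultimately show "\<bar>D j x + E j x\<bar> \<le> M + N" "\<bar>D j x + E j x - (D j y + E j y)\<bar> \<le> (M + N) * \<bar>x - y\<bar>"
    by (auto simp: distrib_right)
qed (use assms in \<open>auto simp: derivative_chain_def intro!: DERIV_add\<close>)

lemma derivative_chain_diff:
  assumes "derivative_chain k D M" "derivative_chain k E N"
  shows "derivative_chain k (\<lambda>j x. D j x - E j x) (M + N)"
  using derivative_chain_add[OF assms(1) derivative_chain_scale[OF assms(2), of "-1"]] by simp

text \<open>Order j gains the factor p^j from the chain rule, and its Lipschitz constant one more
  factor p. The power (1 + p)^(k + 1) dominates all of these, whether p is below or above 1.\<close>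

lemma derivative_chain_affine:
  assumes D: "derivative_chain k D M" and p: "0 < p"
  shows "derivative_chain k (\<lambda>j x. p ^ j * D j (p * x + q)) ((1 + p) ^ Suc k * M)"
  unfolding derivative_chain_def
proof (intro conjI allI impI)
  have M: "0 \<le> M" by (rule derivative_chain_nonneg[OF D])
  fix j x y assume j: "j \<le> k"
  have pj: "p ^ j \<le> (1 + p) ^ k"
    using p j by (intro order_trans[OF power_mono[of p "1 + p"]] power_increasing) auto
  have "p ^ j * \<bar>D j (p * x + q)\<bar> \<le> (1 + p) ^ k * M"
    using D j p unfolding derivative_chain_def by (intro mult_mono pj) auto
  also have "\<dots> \<le> (1 + p) ^ Suc k * M"
    using p M by (intro mult_right_mono power_increasing) auto
  finally show "\<bar>p ^ j * D j (p * x + q)\<bar> \<le> (1 + p) ^ Suc k * M"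
    using p by (simp add: abs_mult)
  have "\<bar>D j (p * x + q) - D j (p * y + q)\<bar> \<le> M * \<bar>(p * x + q) - (p * y + q)\<bar>"
    using D j unfolding derivative_chain_def by blast
  also have "\<dots> = M * p * \<bar>x - y\<bar>"
    using p by (simp add: abs_mult flip: right_diff_distrib)
  finally have "p ^ j * \<bar>D j (p * x + q) - D j (p * y + q)\<bar> \<le> (1 + p) ^ k * (M * p * \<bar>x - y\<bar>)"
    using p by (intro mult_mono pj) auto
  also have "\<dots> \<le> (1 + p) ^ k * (M * (1 + p) * \<bar>x - y\<bar>)"
    using p M by (intro mult_left_mono mult_right_mono) auto
  also have "\<dots> = (1 + p) ^ Suc k * M * \<bar>x - y\<bar>"
    by simp
  finally show "\<bar>p ^ j * D j (p * x + q) - p ^ j * D j (p * y + q)\<bar> \<le> (1 + p) ^ Suc k * M * \<bar>x - y\<bar>"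
    using p by (simp add: abs_mult flip: right_diff_distrib)
next
  fix j x assume "j < k"
  then have "(D j has_real_derivative D (Suc j) (p * x + q)) (at (p * x + q))"
    using D by (auto simp: derivative_chain_def)
  moreover have "((\<lambda>x. p * x + q) has_real_derivative p) (at x)"
    by (auto intro!: derivative_eq_intros)
  ultimately have "((\<lambda>x. D j (p * x + q)) has_real_derivative D (Suc j) (p * x + q) * p) (at x)"
    by (rule DERIV_chain2)
  from DERIV_cmult[OF this, of "p ^ j"]
  show "((\<lambda>x. p ^ j * D j (p * x + q)) has_real_derivative p ^ Suc j * D (Suc j) (p * x + q)) (at x)"
    by (simp add: algebra_simps)
qed

text \<open>
  Iterated moving averages: if \<open>F\<close> is an antiderivative of the step \<open>D 0\<close>, then
  \<open>F x - F (x - 1)\<close> is a step with one more derivative.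
\<close>

lemma smooth_step_exists_aux:
  "\<exists>D M. derivative_chain k D M \<and> (\<forall>x. 0 \<le> D 0 x \<and> D 0 x \<le> 1) \<and>
     (\<forall>x\<le>0. D 0 x = 0) \<and> (\<forall>x\<ge>real (Suc k). D 0 x = 1)"
proof (induction k)
  case 0
  \<comment> \<open>At k = 0 no derivative is asked for, and the clipped ramp has Lipschitz constant
    1.\<close>
  show ?case
    by (rule exI[of _ "\<lambda>_ x. max 0 (min 1 x)"], rule exI[of _ 1]) (auto simp: derivative_chain_def)
next
  case (Suc k)
  then obtain D M where D: "derivative_chain k D M" and D01: "\<And>x. 0 \<le> D 0 x" "\<And>x. D 0 x \<le> 1"
    and D0: "\<And>x. x \<le> 0 \<Longrightarrow> D 0 x = 0" and D1: "\<And>x. x \<ge> real (Suc k) \<Longrightarrow> D 0 x = 1"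
    by blast
  have lip: "\<bar>D 0 x - D 0 y\<bar> \<le> M * \<bar>x - y\<bar>" for x y
    using D by (auto simp: derivative_chain_def)
  have M: "0 \<le> M" by (rule derivative_chain_nonneg[OF D])
  have "continuous_on UNIV (D 0)"
    using lip M by (intro lipschitz_on_continuous_on[of M] lipschitz_onI) (auto simp: dist_real_def)
  then have "isCont (D 0) x" for x
    by (simp add: continuous_on_eq_continuous_at)
  then obtain F where F: "\<And>x. (F has_real_derivative D 0 x) (at x)"
    using einterval_antiderivative[of "-\<infinity>" "\<infinity>" "D 0"]
    by (auto simp: has_real_derivative_iff_has_vector_derivative)
  \<comment> \<open>Differentiating the moving average leaves a backward difference of
    \<open>D 0\<close>; hence order j + 1 of \<open>E\<close> is the backward difference of order j
    of \<open>D\<close>.\<close>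
  define E where "E = (\<lambda>j. case j of 0 \<Rightarrow> (\<lambda>x. F x - F (x - 1)) | Suc i \<Rightarrow> (\<lambda>x. D i x - D i (x - 1)))"
  \<comment> \<open>The new step takes at x a value of the old step from (x - 1, x). It inherits the
    range [0,1] and the left end of the transition, while the right end moves by one unit to k +
    2.\<close>
  have mvt: "\<exists>z. x - 1 < z \<and> z < x \<and> E 0 x = D 0 z" for x
    using MVT2[of "x - 1" x F "D 0"] F by (auto simp: E_def)
  have dE: "(E 0 has_real_derivative E 1 x) (at x)" for x
    unfolding E_def
    by (auto intro!: derivative_eq_intros F DERIV_chain2[of F])
  have E01: "0 \<le> E 0 x" "E 0 x \<le> 1" for x
    using mvt[of x] D01 by auto
  have E1: "\<bar>E 1 x\<bar> \<le> 1" for x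
    using D01[of x] D01[of "x - 1"] by (auto simp: E_def)
  have lipE: "\<bar>E 0 x - E 0 y\<bar> \<le> 1 * \<bar>x - y\<bar>" for x y
    using field_differentiable_bound[of UNIV "E 0" "E 1" 1 x y] dE E1 by (auto simp: norm_minus_commute)
  have sh: "derivative_chain k (\<lambda>j x. D j (x - 1)) (2 ^ Suc k * M)"
    using derivative_chain_affine[OF D, of 1 "- 1"] by simp
  note dd = derivative_chain_diff[OF D sh]
  let ?N = "1 + (M + 2 ^ Suc k * M)"
  have "derivative_chain (Suc k) E ?N"
    unfolding derivative_chain_def
  proof (intro conjI allI impI)
    fix j x assume "j < Suc k"
    then show "(E j has_real_derivative E (Suc j) x) (at x)"
      using dE dd by (cases j) (auto simp: E_def derivative_chain_def)
  next
    fix j x assume "j \<le> Suc k"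
    then show "\<bar>E j x\<bar> \<le> ?N"
    proof (cases j)
      case 0
      then show ?thesis using E01[of x] M by (simp add: add_increasing2)
    next
      case (Suc i)
      then have "\<bar>E j x\<bar> \<le> M + 2 ^ Suc k * M"
        using dd \<open>j \<le> Suc k\<close> by (auto simp: E_def derivative_chain_def)
      then show ?thesis by simp
    qed
  next
    fix j x y assume "j \<le> Suc k"
    then show "\<bar>E j x - E j y\<bar> \<le> ?N * \<bar>x - y\<bar>"
    proof (cases j)
      case 0
      have "1 * \<bar>x - y\<bar> \<le> ?N * \<bar>x - y\<bar>"
        using M by (intro mult_right_mono) auto
      with lipE[of x y] show ?thesis unfolding 0 by (rule order_trans)
    next
      case (Suc i)
      then have "\<bar>E j x - E j y\<bar> \<le> (M + 2 ^ Suc k * M) * \<bar>x - y\<bar>"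
        using dd \<open>j \<le> Suc k\<close> by (auto simp: E_def derivative_chain_def)
      also have "\<dots> \<le> ?N * \<bar>x - y\<bar>"
        by (intro mult_right_mono) auto
      finally show ?thesis .
    qed
  qed
  moreover have "E 0 x = 0" if "x \<le> 0" for x
    using mvt[of x] D0 that by (auto simp: less_le_trans)
  moreover have "E 0 x = 1" if "x \<ge> real (Suc (Suc k))" for x
    using mvt[of x] D1 that by auto
  ultimately show ?case
    using E01 by (intro exI[of _ E] exI[of _ ?N] conjI allI impI)
qed

lemma smooth_step_exists:
  "\<exists>D M. derivative_chain k D M \<and> (\<forall>x. 0 \<le> D 0 x \<and> D 0 x \<le> 1) \<and>
     (\<forall>x\<le>0. D 0 x = 0) \<and> (\<forall>x\<ge>1. D 0 x = 1)"
proof -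
  obtain D M where D: "derivative_chain k D M" "\<forall>x. 0 \<le> D 0 x \<and> D 0 x \<le> 1"
    "\<forall>x\<le>0. D 0 x = 0" "\<forall>x\<ge>real (Suc k). D 0 x = 1"
    using smooth_step_exists_aux by blast
  define p where "p = real (Suc k)"
  have p: "0 < p" by (simp add: p_def)
  have "p * x \<le> 0" if "x \<le> 0" for x using p that by (simp add: mult_le_0_iff)
  moreover have "p \<le> p * x" if "1 \<le> x" for x using p that by simp
  ultimately show ?thesis
    using derivative_chain_affine[OF D(1) p, of 0] D(2-4)
    by (intro exI[of _ "\<lambda>j x. p ^ j * D j (p * x + 0)"] exI[of _ "(1 + p) ^ Suc k * M"])
      (auto simp: p_def)
qed

lemma derivative_chain_support:
  assumes D: "derivative_chain k D M" and U: "open U" and z: "\<And>x. x \<in> U \<Longrightarrow> D 0 x = 0"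
  shows "j \<le> k \<Longrightarrow> x \<in> U \<Longrightarrow> D j x = 0"
proof (induction j arbitrary: x)
  case (Suc j)
  then have "(D j has_real_derivative D (Suc j) x) (at x)"
    using D by (auto simp: derivative_chain_def)
  then have "((\<lambda>_. 0) has_real_derivative D (Suc j) x) (at x)"
    by (rule has_field_derivative_transform_within_open[OF _ U Suc.prems(2)])
      (use Suc.IH Suc.prems(1) in simp)
  then show ?case
    by (rule DERIV_unique) simp
qed (use z in simp)

text \<open>For a smooth step S, the plateau b x = S x - S (x - 9) climbs on [0,1], equals 1 on
  [1,9] and falls on [9,10]. The dipole is the copy of b shifted to [10,20] minus b itself, so its
  integral vanishes. The amplitude 3/4 is below 9/10, the least possible value of f / t in the
  window, which keeps the perturbed function positive there.\<close>

lemma dipole_exists: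
  "\<exists>D M b. derivative_chain k D M \<and> D 0 = (\<lambda>x. 3 / 4 * (b (x - 10) - b x)) \<and>
     (\<forall>x. 0 \<le> b x \<and> b x \<le> 1) \<and> (\<forall>x\<in>{1..9}. b x = 1) \<and> (\<forall>x. x \<notin> {0..10} \<longrightarrow> b x = 0) \<and>
     (\<forall>j\<le>k. \<forall>x. x \<notin> {0..20} \<longrightarrow> D j x = 0) \<and> (LBINT x. D 0 x) = 0"
proof -
  obtain S M where S: "derivative_chain k S M" and S01: "\<And>x. 0 \<le> S 0 x" "\<And>x. S 0 x \<le> 1"
    and S0: "\<And>x. x \<le> 0 \<Longrightarrow> S 0 x = 0" and S1: "\<And>x. x \<ge> 1 \<Longrightarrow> S 0 x = 1"
    using smooth_step_exists[of k] by blast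
  have sh: "derivative_chain k (\<lambda>j x. S j (x + q)) (2 ^ Suc k * M)" for q
    using derivative_chain_affine[OF S, of 1 q] by simp
  define b where "b x = S 0 x - S 0 (x - 9)" for x
  \<comment> \<open>All four translates of S, the trivial one included, have the form
    \<open>x + q\<close>, so that the single fact \<open>sh\<close> covers them.\<close>
  define D where "D j x = 3 / 4 * ((S j (x + - 10) - S j (x + - 19)) - (S j (x + 0) - S j (x + - 9)))" for j x
  obtain N where D: "derivative_chain k D N"
    unfolding D_def[abs_def]
    using derivative_chain_scale[OF derivative_chain_diff[OF
        derivative_chain_diff[OF sh sh] derivative_chain_diff[OF sh sh]]] by blast
  have D0: "D 0 = (\<lambda>x. 3 / 4 * (b (x - 10) - b x))"
    by (simp add: D_def b_def fun_eq_iff algebra_simps)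
  have b01: "0 \<le> b x \<and> b x \<le> 1" for x
    using S01[of x] S01[of "x - 9"] S0[of "x - 9"] S1[of x] by (cases "x \<le> 9") (auto simp: b_def)
  have b1: "b x = 1" if "x \<in> {1..9}" for x
    using that S0 S1 by (auto simp: b_def)
  have b0: "b x = 0" if "x \<notin> {0..10}" for x
    using that S0[of x] S0[of "x - 9"] S1[of x] S1[of "x - 9"] by (cases "x \<le> 0") (auto simp: b_def)
  have lip: "\<bar>S 0 x - S 0 y\<bar> \<le> M * \<bar>x - y\<bar>" for x y
    using S by (auto simp: derivative_chain_def)
  have cont: "continuous_on UNIV (S 0)"
    using lip derivative_chain_nonneg[OF S]
    by (intro lipschitz_on_continuous_on[of M] lipschitz_onI) (auto simp: dist_real_def)
  have "continuous_on UNIV (\<lambda>x. S 0 (x - 9))"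
    by (rule continuous_on_compose2[OF cont]) (auto intro!: continuous_on_diff continuous_on_id continuous_on_const)
  then have "continuous_on UNIV b"
    unfolding b_def[abs_def] by (rule continuous_on_diff[OF cont])
  then have "continuous_on {0..10} b"
    by (rule continuous_on_subset) simp
  then have "integrable lborel (\<lambda>x. indicator {0..10} x *\<^sub>R b x)"
    using borel_integrable_atLeastAtMost'[of 0 10 b] by (simp add: set_integrable_def)
  moreover have "indicator {0..10} x *\<^sub>R b x = b x" for x
    by (cases "x \<in> {0..10}") (simp_all add: b0)
  ultimately have int_b: "integrable lborel b" by (simp only:)
  have shift: "(\<lambda>x. b (x - 10)) = (\<lambda>x. b (-10 + 1 * x))" by simp
  have "integrable lborel (\<lambda>x. b (x - 10))"
    unfolding shift by (rule lborel_integrable_real_affine[OF int_b]) simp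
  moreover have "(LBINT x. b x) = (LBINT x. b (x - 10))"
    unfolding shift by (subst lborel_integral_real_affine[of 1 b "-10"]) simp_all
  ultimately have int_D: "(LBINT x. D 0 x) = 0"
    unfolding D0 using int_b by simp
  have Dz: "D 0 x = 0" if "x \<in> - {0..20}" for x
    using that b0[of x] b0[of "x - 10"] by (auto simp: D0)
  have "open (- {0..20::real})" by (simp add: open_Compl)
  from derivative_chain_support[OF D this Dz]
  have supp: "D j x = 0" if "j \<le> k" "x \<notin> {0..20}" for j x
    using that by simp
  show ?thesis
    by (rule exI[of _ D], rule exI[of _ N], rule exI[of _ b])
      (intro conjI ballI allI impI D D0 b01[THEN conjunct1] b01[THEN conjunct2] b1 b0 supp int_D;
        assumption)
qed

section \<open>Flatness classes\<close>

lemma has_nderiv01_has_vector_derivative: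
  assumes "has_nderiv01 k f" "j < k" "x \<in> {0..1}"
  shows "(nderiv01 j f has_vector_derivative nderiv01 (Suc j) f x) (at x within {0..1})"
  using assms by (simp add: has_nderiv01_def differentiable_on_def vector_derivative_works nderiv01_def)

text \<open>\<open>nderiv01\<close> iterates a choice operator, so additivity is available only
  where derivatives exist. The formula for order j is established on all of [0,1], end points
  included, before the next derivative within [0,1] is taken; uniqueness of derivatives on a closed
  interval then gives order j + 1.\<close>

lemma nderiv01_add_chain:
  assumes f: "has_nderiv01 k f" and E: "derivative_chain k E N"
    and g: "\<And>x. x \<in> {0..1} \<Longrightarrow> g x = f x + E 0 x"
  shows "has_nderiv01 k g" and "\<And>j x. j \<le> k \<Longrightarrow> x \<in> {0..1} \<Longrightarrow> nderiv01 j g x = nderiv01 j f x + E j x"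
proof -
  have step: "(nderiv01 j g has_vector_derivative nderiv01 (Suc j) f x + E (Suc j) x) (at x within {0..1})"
    if "j < k" "x \<in> {0..1}" "\<And>x. x \<in> {0..1} \<Longrightarrow> nderiv01 j g x = nderiv01 j f x + E j x" for j x
  proof -
    have "(E j has_real_derivative E (Suc j) x) (at x within {0..1})"
      using E that(1) by (auto simp: derivative_chain_def intro: has_field_derivative_at_within)
    then have "((\<lambda>x. nderiv01 j f x + E j x) has_vector_derivative nderiv01 (Suc j) f x + E (Suc j) x)
        (at x within {0..1})"
      by (intro has_vector_derivative_add has_nderiv01_has_vector_derivative[OF f] that(1,2))
        (simp add: has_real_derivative_iff_has_vector_derivative)
    then show ?thesis
      by (rule has_vector_derivative_transform[OF that(2) _, rotated]) (simp add: that(3))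
  qed
  have eq: "\<forall>x\<in>{0..1}. nderiv01 j g x = nderiv01 j f x + E j x" if "j \<le> k" for j
    using that
  proof (induction j)
    case 0
    then show ?case using g by (simp add: nderiv01_def)
  next
    case (Suc j)
    show ?case
    proof
      fix x :: real assume x: "x \<in> {0..1}"
      have "vector_derivative (nderiv01 j g) (at x within {0..1}) = nderiv01 (Suc j) f x + E (Suc j) x"
        using Suc by (intro vector_derivative_within_closed_interval[OF _ x] step x) auto
      then show "nderiv01 (Suc j) g x = nderiv01 (Suc j) f x + E (Suc j) x"
        by (simp add: nderiv01_def)
    qed
  qed
  then show "nderiv01 j g x = nderiv01 j f x + E j x" if "j \<le> k" "x \<in> {0..1}" for j x
    using that by blast
  show "has_nderiv01 k g"
    unfolding has_nderiv01_def differentiable_on_def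
  proof (intro allI impI ballI)
    fix j x assume "j < k" "x \<in> {0..1::real}"
    then show "nderiv01 j g differentiable at x within {0..1}"
      using step[of j x] eq[of j] by (auto intro: differentiableI_vector)
  qed
qed

lemma sfloor_bounds:
  assumes "\<beta> > 0"
  shows "real (sfloor \<beta>) < \<beta>" "\<beta> \<le> real (sfloor \<beta>) + 1"
  using sfloor_eq_iff[OF assms, of "sfloor \<beta>"] by auto

lemma le_sfloor_iff:
  assumes "\<beta> > 0"
  shows "j \<le> sfloor \<beta> \<longleftrightarrow> real j < \<beta>"
  using sfloor_bounds[OF assms] by linarith

text \<open>Each supremum in the norm is read off pointwise. The last bound is the \<beta>-th root
  of |f^(j)|^\<beta> <= R^j f^(\<beta> - j); its right-hand side is the scale against which the
  derivatives of a perturbation are measured.\<close>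

lemma flat_classD:
  assumes f: "f \<in> flat_class \<beta> R" and \<beta>: "\<beta> > 0" and R: "R > 0" and x: "x \<in> {0..1}"
  shows "0 \<le> f x" "f x \<le> R" "\<bar>nderiv01 (sfloor \<beta>) f x\<bar> \<le> R"
    and "y \<in> {0..1} \<Longrightarrow> \<bar>nderiv01 (sfloor \<beta>) f x - nderiv01 (sfloor \<beta>) f y\<bar>
           \<le> R * \<bar>x - y\<bar> powr (\<beta> - real (sfloor \<beta>))"
    and "1 \<le> j \<Longrightarrow> j \<le> sfloor \<beta> \<Longrightarrow>
           \<bar>nderiv01 j f x\<bar> \<le> R powr (real j / \<beta>) * f x powr (1 - real j / \<beta>)"
proof -
  let ?k = "sfloor \<beta>"
  have "supnorm01 f + supnorm01 (nderiv01 ?k f) + holder_seminorm \<beta> f + flat_seminorm \<beta> f \<le> ennreal R"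
    using f by (simp add: flat_class_def flat_norm_def holder_norm_def)
  then have s: "supnorm01 f \<le> ennreal R" "supnorm01 (nderiv01 ?k f) \<le> ennreal R"
    "holder_seminorm \<beta> f \<le> ennreal R" "flat_seminorm \<beta> f \<le> ennreal R"
    by (auto intro: order_trans[rotated] simp: add_increasing add_increasing2)
  show f0: "0 \<le> f x" using f x by (auto simp: flat_class_def holder_class_def)
  have "ennreal \<bar>f x\<bar> \<le> ennreal R"
    using s(1) x by (auto simp: supnorm01_def SUP_le_iff)
  then show "f x \<le> R" using R f0 by simp
  have "ennreal \<bar>nderiv01 ?k f x\<bar> \<le> ennreal R"
    using s(2) x by (auto simp: supnorm01_def SUP_le_iff)
  then show "\<bar>nderiv01 ?k f x\<bar> \<le> R" using R by simp
  show "\<bar>nderiv01 ?k f x - nderiv01 ?k f y\<bar> \<le> R * \<bar>x - y\<bar> powr (\<beta> - real ?k)" if y: "y \<in> {0..1}"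
  proof (cases "x = y")
    case False
    have "ennreal (\<bar>nderiv01 ?k f x - nderiv01 ?k f y\<bar> / \<bar>x - y\<bar> powr (\<beta> - real ?k)) \<le> ennreal R"
      using x y False by (intro order_trans[OF SUP_upper2[of "(x, y)"] s(3)[unfolded holder_seminorm_def]]) auto
    then show ?thesis using R False by (simp add: divide_le_eq)
  qed (simp)
  show "\<bar>nderiv01 j f x\<bar> \<le> R powr (real j / \<beta>) * f x powr (1 - real j / \<beta>)" if j: "1 \<le> j" "j \<le> ?k"
  proof -
    have j\<beta>: "real j < \<beta>" using le_sfloor_iff[OF \<beta>] j by simp
    define S where "S = (SUP x\<in>{0..1}. ennreal (\<bar>nderiv01 j f x\<bar> powr \<beta>) / ennreal (\<bar>f x\<bar> powr (\<beta> - real j)))"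
    have "ennreal_root j S \<le> ennreal R"
      using j j\<beta> unfolding S_def by (intro order_trans[OF SUP_upper s(4)[unfolded flat_seminorm_def]]) auto
    then have "S \<noteq> \<infinity>" and "root j (enn2real S) \<le> R"
      using R by (auto simp: ennreal_root_def top_unique split: if_splits)
    then have "enn2real S \<le> R ^ j"
      using j by (metis One_nat_def Suc_le_eq enn2real_nonneg power_mono real_root_ge_zero real_root_pow_pos2)
    then have "S \<le> ennreal (R ^ j)"
      using \<open>S \<noteq> \<infinity>\<close> by (metis ennreal_enn2real_if ennreal_leI infinity_ennreal_def)
    then have q: "ennreal (\<bar>nderiv01 j f x\<bar> powr \<beta>) / ennreal (\<bar>f x\<bar> powr (\<beta> - real j)) \<le> ennreal (R ^ j)"
      using x unfolding S_def by (auto simp: SUP_le_iff)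
    show ?thesis
    \<comment> \<open>At a zero of \<open>f\<close> a finite quotient forces the derivative to
      vanish, since a / 0 is infinite for a > 0.\<close>
    proof (cases "f x = 0")
      case True
      then have "nderiv01 j f x = 0"
        using q \<beta> by (cases "nderiv01 j f x = 0") (auto simp: ennreal_divide_zero top_unique ennreal_divide_eq_top_iff)
      then show ?thesis by simp
    next
      case False
      then have fx: "0 < f x" using f0 by simp
      have "\<bar>nderiv01 j f x\<bar> powr \<beta> / f x powr (\<beta> - real j) \<le> R ^ j"
        using q fx R by (simp add: divide_ennreal)
      then have "\<bar>nderiv01 j f x\<bar> powr \<beta> \<le> R ^ j * f x powr (\<beta> - real j)"
        using fx by (simp add: divide_le_eq)
      then have "(\<bar>nderiv01 j f x\<bar> powr \<beta>) powr (1 / \<beta>) \<le> (R ^ j * f x powr (\<beta> - real j)) powr (1 / \<beta>)"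
        using \<beta> by (intro powr_mono2) auto
      also have "(R ^ j * f x powr (\<beta> - real j)) powr (1 / \<beta>) = R powr (real j / \<beta>) * f x powr (1 - real j / \<beta>)"
        using R \<beta> fx by (simp add: powr_mult powr_powr diff_divide_distrib flip: powr_realpow)
      also have "(\<bar>nderiv01 j f x\<bar> powr \<beta>) powr (1 / \<beta>) = \<bar>nderiv01 j f x\<bar>"
        using \<beta> by (simp add: powr_powr)
      finally show ?thesis .
    qed
  qed
qed

text \<open>Converse of the pointwise bounds, with one constant for each of the four terms of
  \<open>flat_norm\<close>. A factor B in the bounds on the derivatives costs B^\<beta> in the
  flatness seminorm: the j-th root of B^\<beta> R^j is at most B^\<beta> R because B >= 1.\<close>

lemma flat_classI:
  assumes \<beta>: "\<beta> > 0" and R: "R > 0" and B: "1 \<le> B" and A: "0 \<le> A1" "0 \<le> A2" "0 \<le> A3"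
    and f: "f \<in> extensional {0..1}" "\<And>x. x \<in> {0..1} \<Longrightarrow> 0 \<le> f x" "(LBINT x:{0..1}. f x) = 1"
      "has_nderiv01 (sfloor \<beta>) f"
    and b1: "\<And>x. x \<in> {0..1} \<Longrightarrow> f x \<le> A1"
    and b2: "\<And>x. x \<in> {0..1} \<Longrightarrow> \<bar>nderiv01 (sfloor \<beta>) f x\<bar> \<le> A2"
    and b3: "\<And>x y. x \<in> {0..1} \<Longrightarrow> y \<in> {0..1} \<Longrightarrow>
      \<bar>nderiv01 (sfloor \<beta>) f x - nderiv01 (sfloor \<beta>) f y\<bar> \<le> A3 * \<bar>x - y\<bar> powr (\<beta> - real (sfloor \<beta>))"
    and b4: "\<And>j x. 1 \<le> j \<Longrightarrow> j \<le> sfloor \<beta> \<Longrightarrow> x \<in> {0..1} \<Longrightarrow>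
      \<bar>nderiv01 j f x\<bar> \<le> B * R powr (real j / \<beta>) * f x powr (1 - real j / \<beta>)"
    and le: "A1 + A2 + A3 + B powr \<beta> * R \<le> R'"
  shows "f \<in> flat_class \<beta> R'"
proof -
  let ?k = "sfloor \<beta>"
  have s1: "supnorm01 f \<le> ennreal A1"
    unfolding supnorm01_def using f(2) b1 by (intro SUP_least ennreal_leI) auto
  have s2: "supnorm01 (nderiv01 ?k f) \<le> ennreal A2"
    unfolding supnorm01_def using b2 by (intro SUP_least ennreal_leI) auto
  have s3: "holder_seminorm \<beta> f \<le> ennreal A3"
    unfolding holder_seminorm_def
    using b3 by (intro SUP_least) (auto intro!: ennreal_leI simp: divide_le_eq)
  have B1: "1 \<le> B powr \<beta>" using B \<beta> by (simp add: ge_one_powr_ge_zero)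
  have s4: "flat_seminorm \<beta> f \<le> ennreal (B powr \<beta> * R)"
    unfolding flat_seminorm_def
  proof (rule SUP_least)
    fix j :: nat assume "j \<in> {j. 1 \<le> j \<and> real j < \<beta>}"
    then have j: "1 \<le> j" "j \<le> ?k" "real j < \<beta>" using le_sfloor_iff[OF \<beta>] by auto
    let ?S = "SUP x\<in>{0..1}. ennreal (\<bar>nderiv01 j f x\<bar> powr \<beta>) / ennreal (\<bar>f x\<bar> powr (\<beta> - real j))"
    have S: "?S \<le> ennreal ((B powr \<beta> * R) ^ j)"
    proof (rule SUP_least)
      fix x :: real assume x: "x \<in> {0..1}"
      show "ennreal (\<bar>nderiv01 j f x\<bar> powr \<beta>) / ennreal (\<bar>f x\<bar> powr (\<beta> - real j)) \<le> ennreal ((B powr \<beta> * R) ^ j)"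
      proof (cases "f x = 0")
        \<comment> \<open>Here \<open>0 powr p = 0\<close>, so the assumed bound makes the
          derivative vanish, and 0 / 0 = 0 in \<open>ennreal\<close>.\<close>
        case True
        then show ?thesis using b4[OF j(1,2) x] by simp
      next
        case False
        then have fx: "0 < f x" using f(2)[OF x] by simp
        have "\<bar>nderiv01 j f x\<bar> powr \<beta> \<le> (B * R powr (real j / \<beta>) * f x powr (1 - real j / \<beta>)) powr \<beta>"
          using b4[OF j(1,2) x] \<beta> by (intro powr_mono2) auto
        also have "\<dots> = B powr \<beta> * R ^ j * f x powr (\<beta> - real j)"
          using B R fx \<beta> by (simp add: powr_mult powr_powr left_diff_distrib powr_realpow)
        finally have "\<bar>nderiv01 j f x\<bar> powr \<beta> / f x powr (\<beta> - real j) \<le> B powr \<beta> * R ^ j"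
          using fx by (simp add: divide_le_eq)
        also have "\<dots> \<le> (B powr \<beta>) ^ j * R ^ j"
          using B1 R j by (intro mult_right_mono self_le_power) auto
        finally show ?thesis
          using fx by (simp add: divide_ennreal power_mult_distrib ennreal_leI)
      qed
    qed
    then have "?S \<noteq> \<infinity>"
      by (metis S ennreal_neq_top infinity_ennreal_def top_unique)
    moreover have "enn2real ?S \<le> (B powr \<beta> * R) ^ j"
      using S R by (intro enn2real_leI) auto
    then have "root j (enn2real ?S) \<le> root j ((B powr \<beta> * R) ^ j)"
      using j by (intro real_root_le_mono) auto
    then have "root j (enn2real ?S) \<le> B powr \<beta> * R"
      using j R by (simp add: real_root_power_cancel)
    ultimately show "ennreal_root j ?S \<le> ennreal (B powr \<beta> * R)"
      unfolding ennreal_root_def by (simp only: if_False ennreal_leI)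
  qed
  have "flat_norm \<beta> f \<le> ennreal A1 + ennreal A2 + ennreal A3 + ennreal (B powr \<beta> * R)"
    unfolding flat_norm_def holder_norm_def by (intro add_mono s1 s2 s3 s4)
  also have "\<dots> = ennreal (A1 + A2 + A3 + B powr \<beta> * R)"
    using A R by (simp flip: ennreal_plus)
  also have "\<dots> \<le> ennreal R'"
    by (rule ennreal_leI[OF le])
  finally have fn: "flat_norm \<beta> f \<le> ennreal R'" .
  moreover have "holder_norm \<beta> f \<le> flat_norm \<beta> f"
    by (simp add: flat_norm_def)
  ultimately show ?thesis
    using f by (auto simp: flat_class_def holder_class_def)
qed

text \<open>The value (1/10)^(1/\<beta>) serves \<beta> <= 1, where the Hoelder bound alone gives an
  error of at most f x / 10. The value 1/11 serves \<beta> > 1, where the oscillation is first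
  bounded by one eleventh of the maximum.\<close>

definition flat_radius :: "real \<Rightarrow> real" where
  "flat_radius \<beta> = min (1 / 11) ((1 / 10) powr (1 / \<beta>))"

lemma continuous_on_flat_class:
  assumes f: "f \<in> flat_class \<beta> R" and \<beta>: "\<beta> > 0" and R: "R > 0"
  shows "continuous_on {0..1} f"
\<comment> \<open>The value 0 means \<beta> <= 1: no derivative is at hand, but the Hoelder seminorm
  is that of \<open>f\<close> itself.\<close>
proof (cases "sfloor \<beta> = 0")
  case True
  have "uniformly_continuous_on {0..1} f"
    unfolding uniformly_continuous_on_def
  proof (intro allI impI)
    fix e :: real assume e: "0 < e"
    have "dist (f y) (f x) < e" if "x \<in> {0..1}" "y \<in> {0..1}" "dist y x < (e / R) powr (1 / \<beta>)" for x y
    proof -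
      have "\<bar>f y - f x\<bar> \<le> R * \<bar>y - x\<bar> powr \<beta>"
        using flat_classD(4)[OF f \<beta> R that(2,1)] True by (simp add: nderiv01_def)
      also have "\<dots> < R * ((e / R) powr (1 / \<beta>)) powr \<beta>"
        using that(3) \<beta> R by (intro mult_strict_left_mono powr_less_mono2) (auto simp: dist_real_def)
      also have "\<dots> = e" using R e \<beta> by (simp add: powr_powr)
      finally show ?thesis by (simp add: dist_real_def)
    qed
    then show "\<exists>d>0. \<forall>x\<in>{0..1}. \<forall>x'\<in>{0..1}. dist x' x < d \<longrightarrow> dist (f x') (f x) < e"
      using e R by (intro exI[of _ "(e / R) powr (1 / \<beta>)"]) auto
  qed
  then show ?thesis by (rule uniformly_continuous_imp_continuous)
next
  case False
  then have "nderiv01 0 f differentiable_on {0..1}"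
    using f unfolding flat_class_def holder_class_def has_nderiv01_def by blast
  then show ?thesis
    by (intro differentiable_imp_continuous_on) (simp add: nderiv01_def)
qed

text \<open>
  For \<open>\<beta> > 1\<close> the bound on \<open>f'\<close> involves the values of \<open>f\<close> on the segment, so it is first
  applied at the maximum of \<open>f\<close> there, which bootstraps to an upper bound for \<open>f\<close>.
\<close>

lemma flat_class_near:
  assumes f: "f \<in> flat_class \<beta> R" and \<beta>: "\<beta> > 0" and R: "R > 0"
    and x: "x \<in> {0..1}" and y: "y \<in> {0..1}" and fx: "0 < f x"
    and near: "\<bar>y - x\<bar> \<le> flat_radius \<beta> * (f x / R) powr (1 / \<beta>)"
  shows "\<bar>f y - f x\<bar> \<le> f x / 10"
proof (cases "sfloor \<beta> = 0")
  case True
  have "\<bar>f y - f x\<bar> \<le> R * \<bar>y - x\<bar> powr \<beta>"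
    using flat_classD(4)[OF f \<beta> R y x] True by (simp add: nderiv01_def)
  also have "\<dots> \<le> R * ((1 / 10) powr (1 / \<beta>) * (f x / R) powr (1 / \<beta>)) powr \<beta>"
    using near R \<beta>
    by (intro mult_left_mono powr_mono2 order_trans[OF near] mult_right_mono) (auto simp: flat_radius_def)
  also have "\<dots> = f x / 10"
    using R \<beta> fx by (simp add: powr_mult powr_powr powr_divide)
  finally show ?thesis .
next
  case False
  then have k: "1 \<le> sfloor \<beta>" by simp
  then have \<beta>1: "1 < \<beta>" using le_sfloor_iff[OF \<beta>, of 1] by simp
  have hn: "has_nderiv01 (sfloor \<beta>) f" using f by (simp add: flat_class_def holder_class_def)
  let ?S = "closed_segment x y"
  have S: "?S \<subseteq> {0..1}" using x y by (auto simp: closed_segment_eq_real_ivl split: if_splits)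
  obtain z where z: "z \<in> ?S" "\<And>u. u \<in> ?S \<Longrightarrow> f u \<le> f z"
    using continuous_attains_sup[of ?S f] continuous_on_subset[OF continuous_on_flat_class[OF f \<beta> R] S]
    by auto
  let ?K = "R powr (1 / \<beta>) * f z powr (1 - 1 / \<beta>)"
  have xz: "f x \<le> f z" using z(2)[of x] by simp
  have bound: "\<bar>f v - f x\<bar> \<le> f z / 11" if v: "v \<in> ?S" for v
  proof -
    have "norm (f v - f x) \<le> ?K * norm (v - x)"
    proof (rule field_differentiable_bound[of ?S f "nderiv01 1 f" ?K])
      fix u assume u: "u \<in> ?S"
      have "(f has_vector_derivative nderiv01 1 f u) (at u within {0..1})"
        using has_nderiv01_has_vector_derivative[OF hn, of 0 u] k u S by (auto simp: nderiv01_def)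
      then show "(f has_real_derivative nderiv01 1 f u) (at u within ?S)"
        unfolding has_real_derivative_iff_has_vector_derivative
        using has_vector_derivative_within_subset S by blast
      have "\<bar>nderiv01 1 f u\<bar> \<le> R powr (1 / \<beta>) * f u powr (1 - 1 / \<beta>)"
        using flat_classD(5)[OF f \<beta> R _ _ k, of u] u S by auto
      also have "\<dots> \<le> ?K"
        using u z(2) \<beta>1 flat_classD(1)[OF f \<beta> R] S by (intro mult_left_mono powr_mono2) auto
      finally show "norm (nderiv01 1 f u) \<le> ?K" by simp
    qed (use v in auto)
    also have "\<dots> \<le> ?K * (1 / 11 * (f x / R) powr (1 / \<beta>))"
    proof (rule mult_left_mono)
      have "\<bar>v - x\<bar> \<le> \<bar>y - x\<bar>"
        using v by (auto simp: closed_segment_eq_real_ivl split: if_splits)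
      also have "\<dots> \<le> 1 / 11 * (f x / R) powr (1 / \<beta>)"
        by (intro order_trans[OF near] mult_right_mono) (auto simp: flat_radius_def)
      finally show "norm (v - x) \<le> 1 / 11 * (f x / R) powr (1 / \<beta>)" by simp
    qed simp
    also have "\<dots> = f z powr (1 - 1 / \<beta>) * f x powr (1 / \<beta>) / 11"
      using R fx by (simp add: powr_divide)
    also have "\<dots> \<le> f z powr (1 - 1 / \<beta>) * f z powr (1 / \<beta>) / 11"
      using xz fx \<beta> by (intro divide_right_mono mult_left_mono powr_mono2) auto
    also have "\<dots> = f z / 11"
      using xz fx by (simp flip: powr_add)
    finally show ?thesis by simp
  qed
  \<comment> \<open>At the maximiser z the bound reads f z - f x <= f z / 11. This removes f z from
    the estimate, since then f z / 11 <= f x / 10.\<close>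
  have "f z \<le> 11 / 10 * f x" using bound[OF z(1)] xz by linarith
  then show ?thesis using bound[of y] by simp
qed

section \<open>Perturbation inside the window\<close>

text \<open>Interpolation: at distance at least 1 the uniform bound suffices, and below 1 the
  Lipschitz bound does, because there |x - y| <= |x - y|^\<gamma>.\<close>

lemma derivative_chain_holder:
  assumes D: "derivative_chain k D M" and j: "j \<le> k" and \<gamma>: "0 < \<gamma>" "\<gamma> \<le> 1"
  shows "\<bar>D j x - D j y\<bar> \<le> 2 * M * \<bar>x - y\<bar> powr \<gamma>"
proof (cases "x = y \<or> 1 \<le> \<bar>x - y\<bar>")
  case True
  have "\<bar>D j x\<bar> \<le> M" "\<bar>D j y\<bar> \<le> M"
    using D j by (auto simp: derivative_chain_def)
  then have "\<bar>D j x - D j y\<bar> \<le> 2 * M * 1" by linarith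
  moreover have "1 \<le> \<bar>x - y\<bar> powr \<gamma>" if "1 \<le> \<bar>x - y\<bar>"
    using \<gamma> that by (intro ge_one_powr_ge_zero) auto
  ultimately show ?thesis
    using True derivative_chain_nonneg[OF D]
    by (cases "x = y") (auto intro: order_trans[OF _ mult_left_mono[of 1 _ "2 * M"]])
next
  case False
  note M = derivative_chain_nonneg[OF D]
  have "\<bar>D j x - D j y\<bar> \<le> M * \<bar>x - y\<bar> powr 1"
    using D j by (auto simp: derivative_chain_def)
  also have "\<dots> \<le> (2 * M) * \<bar>x - y\<bar> powr \<gamma>"
    using False \<gamma> M by (intro mult_mono powr_mono') auto
  finally show ?thesis by simp
qed

text \<open>The scaling that makes c independent of R. The size t h^(-j) of the j-th derivative of
  the perturbation is \<kappa>^(-j) times what the flatness bound with constant R permits at level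
  t, and the size t h^(-\<beta>) of its Hoelder seminorm is \<kappa>^(-\<beta>) R.\<close>

lemma scale_identities:
  fixes \<kappa> t R \<beta> h :: real
  assumes \<kappa>: "0 < \<kappa>" and t: "0 < t" and R: "0 < R" and \<beta>: "0 < \<beta>"
    and h: "h = \<kappa> * (t / R) powr (1 / \<beta>)"
  shows "t * (1 / h) ^ j = (1 / \<kappa>) ^ j * (R powr (real j / \<beta>) * t powr (1 - real j / \<beta>))"
    and "h powr \<beta> = \<kappa> powr \<beta> * t / R"
proof -
  show "h powr \<beta> = \<kappa> powr \<beta> * t / R"
    using assms by (simp add: powr_mult powr_powr)
  have "h ^ j = \<kappa> ^ j * ((t / R) powr (1 / \<beta>)) powr real j"
    using t R by (simp add: h power_mult_distrib powr_realpow)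
  also have "\<dots> = \<kappa> ^ j * (t powr (real j / \<beta>) / R powr (real j / \<beta>))"
    using t R by (simp add: powr_powr powr_divide)
  finally have "t * (1 / h) ^ j = t / (\<kappa> ^ j * (t powr (real j / \<beta>) / R powr (real j / \<beta>)))"
    by (simp add: power_one_over)
  also have "\<dots> = (1 / \<kappa>) ^ j * (R powr (real j / \<beta>) * t powr (1 - real j / \<beta>))"
    using t by (simp add: powr_diff power_one_over)
  finally show "t * (1 / h) ^ j = (1 / \<kappa>) ^ j * (R powr (real j / \<beta>) * t powr (1 - real j / \<beta>))" .
qed

lemma powr_mult_le:
  fixes a x y p :: real
  assumes "0 \<le> x" "x \<le> a * y" "1 \<le> a" "0 \<le> p" "p \<le> 1" "0 \<le> y"
  shows "x powr p \<le> a * y powr p"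
proof -
  have "x powr p \<le> (a * y) powr p"
    using assms by (intro powr_mono2) auto
  also have "\<dots> = a powr p * y powr p"
    using assms by (simp add: powr_mult)
  also have "\<dots> \<le> a powr 1 * y powr p"
    using assms by (intro mult_right_mono powr_mono) auto
  finally show ?thesis using assms by simp
qed

text \<open>Bounds the norm of the perturbed function divided by R; neither R nor t occurs. The
  summand 8 covers the sup norm (2) and the shares of \<open>f\<close> in the top derivative and in
  the Hoelder seminorm (1 each). The last summand belongs to the flatness seminorm.\<close>

definition perturbation_const :: "real \<Rightarrow> real \<Rightarrow> real \<Rightarrow> real" where
  "perturbation_const \<beta> \<kappa> M = 8 + M * (1 / \<kappa>) ^ sfloor \<beta> + 2 * M / \<kappa> powr \<beta>
     + (8 * (1 + 2 * M * (1 / \<kappa>) ^ sfloor \<beta>)) powr \<beta>"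

definition perturbation :: "(real \<Rightarrow> real) \<Rightarrow> real \<Rightarrow> real \<Rightarrow> real \<Rightarrow> (real \<Rightarrow> real) \<Rightarrow> real \<Rightarrow> real" where
  "perturbation f t a h \<psi> = (\<lambda>x\<in>{0..1}. f x + t * \<psi> ((x - a) / h))"

text \<open>Outside the window nothing changes. Inside, f and t are comparable, so bounds for the
  dipole in terms of t become bounds in terms of f and, by g >= f / 8, in terms of g. The last
  conversion is essential because the flatness seminorm compares the derivatives of g with g
  itself.\<close>

lemma perturbation_in_flat_class:
  fixes b :: "real \<Rightarrow> real"
  assumes \<beta>: "0 < \<beta>" and D: "derivative_chain (sfloor \<beta>) D M"
    and D0: "D 0 = (\<lambda>x. 3 / 4 * (b (x - 10) - b x))" and b: "\<And>x. 0 \<le> b x" "\<And>x. b x \<le> 1"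
    and supp: "\<And>j x. j \<le> sfloor \<beta> \<Longrightarrow> x \<notin> {0..20} \<Longrightarrow> D j x = 0" and int0: "(LBINT x. D 0 x) = 0"
    and f: "f \<in> flat_class \<beta> R" and R: "1 \<le> R" and t: "0 < t" "t \<le> 1" and \<kappa>: "0 < \<kappa>" "\<kappa> \<le> 1"
    and h: "h = \<kappa> * (t / R) powr (1 / \<beta>)" and a: "0 \<le> a" "a + 20 * h \<le> 1"
    and near: "\<And>x. x \<in> {a..a + 20 * h} \<Longrightarrow> \<bar>f x - t\<bar> \<le> t / 10"
  defines "g \<equiv> perturbation f t a h (D 0)"
  shows "g \<in> flat_class \<beta> (perturbation_const \<beta> \<kappa> M * R)"
    and "\<And>x. x \<in> {0..1} \<Longrightarrow> f x / 8 \<le> g x \<and> g x \<le> 2 * f x"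
proof -
  let ?k = "sfloor \<beta>"
  let ?W = "{a..a + 20 * h}"
  note M = derivative_chain_nonneg[OF D]
  note k = sfloor_bounds[OF \<beta>]
  have R0: "0 < R" using R by simp
  have hpos: "0 < h" using \<kappa> t R by (simp add: h)
  have W: "?W \<subseteq> {0..1}" using a by auto
  define E where "E j x = t * ((1 / h) ^ j * D j (1 / h * x + - (a / h)))" for j x
  obtain N where E: "derivative_chain ?k E N"
    unfolding E_def[abs_def]
    using derivative_chain_scale[OF derivative_chain_affine[OF D, of "1 / h" "- (a / h)"]] hpos by auto
  have arg: "1 / h * x + - (a / h) = (x - a) / h" for x by (simp add: diff_divide_distrib)
  have E0: "E 0 x = t * D 0 ((x - a) / h)" for x by (simp add: E_def diff_divide_distrib)
  have g: "g x = f x + E 0 x" if "x \<in> {0..1}" for x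
    using that by (simp add: g_def perturbation_def E0)
  have Esupp: "E j x = 0" if "j \<le> ?k" "x \<notin> ?W" for j x
  proof -
    have "(x - a) / h \<notin> {0..20}"
      using that(2) hpos by (auto simp: field_simps)
    then have "D j ((x - a) / h) = 0" by (rule supp[OF that(1)])
    then show ?thesis by (simp only: E_def arg mult_zero_right)
  qed
  have hn: "has_nderiv01 ?k f" and fint: "(LBINT x:{0..1}. f x) = 1"
    using f by (auto simp: flat_class_def holder_class_def)
  have nd1: "has_nderiv01 ?k g"
    by (rule nderiv01_add_chain(1)[OF hn E g])
  have nd2: "nderiv01 j g x = nderiv01 j f x + E j x" if "j \<le> ?k" "x \<in> {0..1}" for j x
    by (rule nderiv01_add_chain(2)[OF hn E g that])
  note fD = flat_classD[OF f \<beta> R0]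
  have fW: "9 / 10 * t \<le> f x" "f x \<le> 11 / 10 * t" if "x \<in> ?W" for x
    using near[OF that] by linarith+
  show comp: "f x / 8 \<le> g x \<and> g x \<le> 2 * f x" if x: "x \<in> {0..1}" for x
  proof (cases "x \<in> ?W")
    case True
    have "\<bar>D 0 y\<bar> \<le> 3 / 4" for y
      using b[of y] b[of "y - 10"] by (simp add: D0 abs_le_iff)
    then have "\<bar>E 0 x\<bar> \<le> t * (3 / 4)"
      using t by (simp add: E0 abs_mult)
    \<comment> \<open>From below, g >= 9/10 t - 3/4 t = 3/20 t, which is above 11/80 t >= f / 8.
      From above, 3/4 t <= 5/6 f.\<close>
    then show ?thesis using fW[OF True] g[OF x] by (auto simp: abs_le_iff)
  next
    case False
    then show ?thesis using g[OF x] Esupp[of 0 x] fD(1)[OF x] by simp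
  qed
  have Ebound: "\<bar>E j x\<bar> \<le> M * (1 / \<kappa>) ^ ?k * (R powr (real j / \<beta>) * t powr (1 - real j / \<beta>))" if j: "j \<le> ?k" for j x
  proof -
    have "\<bar>E j x\<bar> = t * (1 / h) ^ j * \<bar>D j ((x - a) / h)\<bar>"
      using t hpos unfolding E_def arg by (simp add: abs_mult)
    also have "\<dots> = (1 / \<kappa>) ^ j * (R powr (real j / \<beta>) * t powr (1 - real j / \<beta>)) * \<bar>D j ((x - a) / h)\<bar>"
      unfolding scale_identities(1)[OF \<kappa>(1) t(1) R0 \<beta> h] ..
    also have "\<dots> \<le> (1 / \<kappa>) ^ ?k * (R powr (real j / \<beta>) * t powr (1 - real j / \<beta>)) * M"
      using D j \<kappa> unfolding derivative_chain_def
      by (intro mult_mono power_increasing mult_nonneg_nonneg) auto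
    finally show ?thesis by (simp add: mult_ac)
  qed
  show "g \<in> flat_class \<beta> (perturbation_const \<beta> \<kappa> M * R)"
  proof (rule flat_classI[OF \<beta> R0])
    \<comment> \<open>The 1 is the share of \<open>f\<close>, the 2 replaces t by f inside the
      window, and the 8 replaces f by g.\<close>
    let ?B = "8 * (1 + 2 * M * (1 / \<kappa>) ^ ?k)"
    let ?A2 = "R + M * (1 / \<kappa>) ^ ?k * R"
    let ?A3 = "R + 2 * M / \<kappa> powr \<beta> * R"
    show "1 \<le> ?B" "0 \<le> 2 * R" "0 \<le> ?A2" "0 \<le> ?A3"
      using M \<kappa> R by (auto intro!: add_nonneg_nonneg mult_nonneg_nonneg)
    show "2 * R + ?A2 + ?A3 + ?B powr \<beta> * R \<le> perturbation_const \<beta> \<kappa> M * R"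
      using R by (simp add: perturbation_const_def algebra_simps)
    show "g \<in> extensional {0..1}" by (simp add: g_def perturbation_def)
    show "0 \<le> g x" "g x \<le> 2 * R" if "x \<in> {0..1}" for x
      using comp[OF that] fD(1,2)[OF that] by linarith+
    show "has_nderiv01 ?k g" by (rule nd1)
    show "(LBINT x:{0..1}. g x) = 1"
    proof -
      have fi: "set_integrable lborel {0..1} f"
        by (intro borel_integrable_atLeastAtMost' continuous_on_flat_class[OF f \<beta> R0])
      have "continuous_on UNIV (E 0)"
        using E derivative_chain_nonneg[OF E]
        by (intro lipschitz_on_continuous_on[of N] lipschitz_onI) (auto simp: dist_real_def derivative_chain_def)
      then have Ei: "set_integrable lborel {0..1} (E 0)"
        by (intro borel_integrable_atLeastAtMost') (rule continuous_on_subset, auto)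
      have "(LBINT x:{0..1}. E 0 x) = (LBINT x. E 0 x)"
        unfolding set_lebesgue_integral_def
        using Esupp[of 0] W by (intro Bochner_Integration.integral_cong) (auto split: split_indicator)
      also have "\<dots> = t * (LBINT x. D 0 (- (a / h) + 1 / h * x))"
        by (simp add: E_def add.commute)
      also have "(LBINT x. D 0 (- (a / h) + 1 / h * x)) = 0"
        using lborel_integral_real_affine[of "1 / h" "D 0" "- (a / h)"] hpos int0 by simp
      finally have "(LBINT x:{0..1}. f x + E 0 x) = 1"
        using set_integral_add(2)[OF fi Ei] fint by simp
      moreover have "(LBINT x:{0..1}. g x) = (LBINT x:{0..1}. f x + E 0 x)"
        using g by (intro set_lebesgue_integral_cong) auto
      ultimately show ?thesis by simp
    qed
    show "\<bar>nderiv01 ?k g x\<bar> \<le> ?A2" if x: "x \<in> {0..1}" for x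
    proof -
      \<comment> \<open>This is where R >= 1 and t <= 1 enter: the exponents are at most 1 and at
        least 0 respectively.\<close>
      have "R powr (real ?k / \<beta>) * t powr (1 - real ?k / \<beta>) \<le> R powr 1 * 1"
        using R t k \<beta> by (intro mult_mono powr_mono powr_le1) auto
      then have "M * (1 / \<kappa>) ^ ?k * (R powr (real ?k / \<beta>) * t powr (1 - real ?k / \<beta>)) \<le> M * (1 / \<kappa>) ^ ?k * R"
        using M \<kappa> R by (intro mult_left_mono) auto
      then have "\<bar>E ?k x\<bar> \<le> M * (1 / \<kappa>) ^ ?k * R"
        using Ebound[of ?k x] by linarith
      then show ?thesis using nd2[OF order_refl x] fD(3)[OF x] by linarith
    qed
    show "\<bar>nderiv01 ?k g x - nderiv01 ?k g y\<bar> \<le> ?A3 * \<bar>x - y\<bar> powr (\<beta> - real ?k)"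
      if x: "x \<in> {0..1}" and y: "y \<in> {0..1}" for x y
    proof -
      let ?\<gamma> = "\<beta> - real ?k"
      let ?u = "(x - a) / h" and ?v = "(y - a) / h"
      have "\<bar>E ?k x - E ?k y\<bar> = t * (1 / h) ^ ?k * \<bar>D ?k ?u - D ?k ?v\<bar>"
        using t hpos unfolding E_def arg by (simp add: abs_mult flip: right_diff_distrib)
      also have "\<dots> \<le> t * (1 / h) ^ ?k * (2 * M * \<bar>?u - ?v\<bar> powr ?\<gamma>)"
        using t hpos k by (intro mult_left_mono derivative_chain_holder[OF D]) auto
      also have "\<bar>?u - ?v\<bar> powr ?\<gamma> = \<bar>x - y\<bar> powr ?\<gamma> / h powr ?\<gamma>"
        using hpos by (simp add: powr_divide abs_divide flip: diff_divide_distrib)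
      also have "t * (1 / h) ^ ?k * (2 * M * (\<bar>x - y\<bar> powr ?\<gamma> / h powr ?\<gamma>))
          = 2 * M * \<bar>x - y\<bar> powr ?\<gamma> * (t / (h powr real ?k * h powr ?\<gamma>))"
        using hpos by (simp add: power_one_over powr_realpow)
      \<comment> \<open>The exponents add up to \<beta>, so t cancels and a constant multiple of R
        remains.\<close>
      also have "h powr real ?k * h powr ?\<gamma> = \<kappa> powr \<beta> * t / R"
        using scale_identities(2)[OF \<kappa>(1) t(1) R0 \<beta> h] by (simp flip: powr_add)
      also have "2 * M * \<bar>x - y\<bar> powr ?\<gamma> * (t / (\<kappa> powr \<beta> * t / R)) = 2 * M / \<kappa> powr \<beta> * R * \<bar>x - y\<bar> powr ?\<gamma>"
        using t by simp
      finally have "\<bar>E ?k x - E ?k y\<bar> \<le> 2 * M / \<kappa> powr \<beta> * R * \<bar>x - y\<bar> powr ?\<gamma>" .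
      then show ?thesis
        using nd2[OF order_refl x] nd2[OF order_refl y] fD(4)[OF x y]
        unfolding distrib_right by linarith
    qed
    show "\<bar>nderiv01 j g x\<bar> \<le> ?B * R powr (real j / \<beta>) * g x powr (1 - real j / \<beta>)"
      if j: "1 \<le> j" "j \<le> ?k" and x: "x \<in> {0..1}" for j x
    proof -
      let ?p = "1 - real j / \<beta>"
      let ?Q = "M * (1 / \<kappa>) ^ ?k"
      have p: "0 \<le> ?p" "?p \<le> 1" using j k \<beta> by auto
      have Q: "0 \<le> ?Q" using M \<kappa> by simp
      have "\<bar>E j x\<bar> \<le> ?Q * (R powr (real j / \<beta>) * (2 * f x powr ?p))"
      proof (cases "x \<in> ?W")
        case True
        have "t powr ?p \<le> 2 * f x powr ?p"
          using fW[OF True] t p by (intro powr_mult_le) auto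
        then have "?Q * (R powr (real j / \<beta>) * t powr ?p) \<le> ?Q * (R powr (real j / \<beta>) * (2 * f x powr ?p))"
          using Q by (intro mult_left_mono) auto
        then show ?thesis using Ebound[OF j(2), of x] by linarith
      next
        case False
        then show ?thesis using Esupp[OF j(2) False] Q by simp
      qed
      then have "\<bar>nderiv01 j g x\<bar> \<le> R powr (real j / \<beta>) * f x powr ?p + ?Q * (R powr (real j / \<beta>) * (2 * f x powr ?p))"
        using nd2[OF j(2) x] fD(5)[OF x j] by linarith
      also have "\<dots> = (1 + 2 * ?Q) * R powr (real j / \<beta>) * f x powr ?p"
        by (simp add: algebra_simps)
      also have "\<dots> \<le> (1 + 2 * ?Q) * R powr (real j / \<beta>) * (8 * g x powr ?p)"
        using M \<kappa> comp[OF x] fD(1)[OF x] p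
        by (intro mult_left_mono powr_mult_le mult_nonneg_nonneg add_nonneg_nonneg) auto
      also have "\<dots> = ?B * R powr (real j / \<beta>) * g x powr ?p"
        by (simp add: algebra_simps)
      finally show ?thesis .
    qed
  qed
qed

section \<open>Effect of the perturbation in the two experiments\<close>

lemma perturbation_excess_mass:
  fixes b :: "real \<Rightarrow> real"
  assumes \<psi>: "\<psi> = (\<lambda>x. 3 / 4 * (b (x - 10) - b x))" and b: "\<And>x. 0 \<le> b x" "\<And>x. b x \<le> 1"
    and b0: "\<And>x. x \<notin> {0..10} \<Longrightarrow> b x = 0"
    and h: "0 < h" and t: "0 < t" and nth: "real n * t * h = 1 / 200"
  shows "of_nat n * (\<integral>\<^sup>+x\<in>{0..1}. ennreal (perturbation f t a h \<psi> x - f x) \<partial>lborel) \<le> ennreal (3 / 80)"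
proof -
  \<comment> \<open>Only the positive half of the dipole counts, as \<open>ennreal\<close> truncates
    negative values: height at most 3/4 t on length 10 h, so that n times the integral is at most
    7.5 n t h = 3/80.\<close>
  let ?I = "{a + 10 * h..a + 20 * h}"
  have "t * \<psi> ((x - a) / h) \<le> 3 / 4 * t * indicator ?I x" for x
  proof (cases "x \<in> ?I")
    case True
    have "\<psi> ((x - a) / h) \<le> 3 / 4"
      using b(1)[of "(x - a) / h"] b(2)[of "(x - a) / h - 10"] by (simp add: \<psi>)
    then have "t * \<psi> ((x - a) / h) \<le> t * (3 / 4)"
      using t by (intro mult_left_mono) auto
    then show ?thesis using True by simp
  next
    case False
    then have "(x - a) / h - 10 \<notin> {0..10}"
      using h by (auto simp: field_simps)
    then have "b ((x - a) / h - 10) = 0" by (rule b0)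
    then show ?thesis
      using False t b(1)[of "(x - a) / h"] by (simp add: \<psi> mult_le_0_iff)
  qed
  then have "(\<integral>\<^sup>+x\<in>{0..1}. ennreal (perturbation f t a h \<psi> x - f x) \<partial>lborel)
      \<le> (\<integral>\<^sup>+x. ennreal (3 / 4 * t) * indicator ?I x \<partial>lborel)"
    using t by (intro nn_integral_mono)
      (auto simp: perturbation_def ennreal_mult'[symmetric] ennreal_indicator[symmetric] split: split_indicator
        intro!: ennreal_leI split: split_indicator_asm)
  also have "\<dots> = ennreal (3 / 4 * t) * ennreal (10 * h)"
    using h by (simp add: nn_integral_cmult_indicator)
  also have "\<dots> = ennreal (30 / 4 * (t * h))"
    using t h by (simp flip: ennreal_mult add: mult_ac)
  finally have "of_nat n * (\<integral>\<^sup>+x\<in>{0..1}. ennreal (perturbation f t a h \<psi> x - f x) \<partial>lborel)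
      \<le> ennreal (real n) * ennreal (30 / 4 * (t * h))"
    unfolding ennreal_of_nat_eq_real_of_nat by (rule mult_left_mono) simp
  also have "\<dots> = ennreal (30 / 4 * (real n * t * h))"
    using t h by (simp flip: ennreal_mult add: mult_ac)
  finally show ?thesis unfolding nth by simp
qed

text \<open>The drop is 3/4 t divided by the sum of the two roots. These are at most 21/20 and 3/5
  times sqrt t, since 1.1 <= (21/20)^2 and 0.35 <= (3/5)^2, so the quotient is at least 5/11 sqrt t,
  slightly more than claimed.\<close>

lemma sqrt_drop:
  fixes x t :: real
  assumes t: "0 < t" and x: "\<bar>x - t\<bar> \<le> t / 10"
  shows "9 / 20 * sqrt t \<le> sqrt x - sqrt (x - 3 / 4 * t)"
proof -
  let ?s = "sqrt t" and ?u = "sqrt x" and ?v = "sqrt (x - 3 / 4 * t)"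
  have x': "9 / 10 * t \<le> x" "x \<le> 11 / 10 * t" using x by linarith+
  have "?u \<le> sqrt ((21 / 20)\<^sup>2 * t)"
    using x' t by (intro real_sqrt_le_mono) (simp add: power2_eq_square)
  then have u: "?u \<le> 21 / 20 * ?s" by (simp add: real_sqrt_mult)
  have "?v \<le> sqrt ((3 / 5)\<^sup>2 * t)"
    using x' t by (intro real_sqrt_le_mono) (simp add: power2_eq_square)
  then have v: "?v \<le> 3 / 5 * ?s" by (simp add: real_sqrt_mult)
  have s: "0 < ?s" using t by simp
  have d: "0 \<le> ?u - ?v" using t by simp
  have "3 / 4 * (?s * ?s) = (?u - ?v) * (?u + ?v)"
    using x' t by (simp add: algebra_simps)
  also have "\<dots> \<le> (?u - ?v) * (33 / 20 * ?s)"
    using u v d by (intro mult_left_mono) auto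
  finally have "?s * (3 / 4 * ?s) \<le> ?s * ((?u - ?v) * (33 / 20))"
    by (simp only: mult_ac)
  then have "3 / 4 * ?s \<le> (?u - ?v) * (33 / 20)"
    using s by (rule mult_left_le_imp_le)
  then have "5 / 11 * ?s \<le> ?u - ?v" by (simp add: field_simps)
  moreover have "9 / 20 * ?s \<le> 5 / 11 * ?s" using s by (intro mult_right_mono) auto
  ultimately show ?thesis by (rule order_trans[rotated])
qed

text \<open>On [a + h, a + 9 h] the plateau of b makes the perturbation exactly -3/4 t. The drop of
  the root, at least 9/20 sqrt t, times the length 8 h and the factor 2 of the drift gives 36/5 sqrt
  t h; the ramps of the dipole are left out.\<close>

lemma perturbation_drift:
  fixes b :: "real \<Rightarrow> real" and f :: "real \<Rightarrow> real"
  assumes \<psi>: "\<psi> = (\<lambda>x. 3 / 4 * (b (x - 10) - b x))" and b1: "\<And>x. x \<in> {1..9} \<Longrightarrow> b x = 1"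
    and b0: "\<And>x. x \<notin> {0..10} \<Longrightarrow> b x = 0"
    and h: "0 < h" and t: "0 < t" and a: "0 \<le> a" "a + 20 * h \<le> 1"
    and near: "\<And>x. x \<in> {a..a + 20 * h} \<Longrightarrow> \<bar>f x - t\<bar> \<le> t / 10"
    and cf: "continuous_on {0..1} f" and cg: "continuous_on {0..1} (perturbation f t a h \<psi>)"
  defines "D \<equiv> \<lambda>u. 2 * (LBINT s:{0..a + 9 * h}. sqrt (u s)) - 2 * (LBINT s:{0..a + h}. sqrt (u s))"
  shows "36 / 5 * sqrt t * h \<le> D f - D (perturbation f t a h \<psi>)"
proof -
  let ?g = "perturbation f t a h \<psi>"
  let ?l = "a + h" and ?m = "a + 9 * h"
  have D: "D u = 2 * integral {?l..?m} (\<lambda>s. sqrt (u s))" and int: "(\<lambda>s. sqrt (u s)) integrable_on {?l..?m}"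
    if u: "continuous_on {0..1} u" for u
  proof -
    have c: "continuous_on {x..y} (\<lambda>s. sqrt (u s))" if "0 \<le> x" "y \<le> 1" for x y
      using that by (intro continuous_on_real_sqrt continuous_on_subset[OF u]) auto
    have L: "(LBINT s:{0..y}. sqrt (u s)) = integral {0..y} (\<lambda>s. sqrt (u s))" if "y \<le> 1" for y
      using that by (intro set_borel_integral_eq_integral(2) borel_integrable_atLeastAtMost' c) auto
    have "(\<lambda>s. sqrt (u s)) integrable_on {0..?m}"
      using a h by (intro integrable_continuous_real c) auto
    then have "integral {0..?l} (\<lambda>s. sqrt (u s)) + integral {?l..?m} (\<lambda>s. sqrt (u s)) = integral {0..?m} (\<lambda>s. sqrt (u s))"
      using a h by (intro Henstock_Kurzweil_Integration.integral_combine) auto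
    moreover have "?l \<le> 1" "?m \<le> 1" using a h by auto
    ultimately show "D u = 2 * integral {?l..?m} (\<lambda>s. sqrt (u s))"
      unfolding D_def by (simp add: L)
    show "(\<lambda>s. sqrt (u s)) integrable_on {?l..?m}"
      using a h by (intro integrable_continuous_real c) auto
  qed
  have "9 / 20 * sqrt t \<le> sqrt (f x) - sqrt (?g x)" if x: "x \<in> {?l..?m}" for x
  proof -
    have W: "x \<in> {a..a + 20 * h}" and x01: "x \<in> {0..1}" using x a h by auto
    have "(x - a) / h \<in> {1..9}" using x h by (auto simp: field_simps)
    moreover from this have "(x - a) / h - 10 \<notin> {0..10}" by auto
    ultimately have "b ((x - a) / h) = 1" "b ((x - a) / h - 10) = 0"
      using b1 b0 by blast+
    then have "?g x = f x - 3 / 4 * t" using x01 by (simp add: perturbation_def \<psi>)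
    then show ?thesis using sqrt_drop[OF t near[OF W]] by simp
  qed
  then have "integral {?l..?m} (\<lambda>x. 9 / 20 * sqrt t) \<le> integral {?l..?m} (\<lambda>x. sqrt (f x) - sqrt (?g x))"
    using int[OF cf] int[OF cg] by (intro integral_le integrable_diff) auto
  also have "\<dots> = integral {?l..?m} (\<lambda>x. sqrt (f x)) - integral {?l..?m} (\<lambda>x. sqrt (?g x))"
    using int[OF cf] int[OF cg] by (rule integral_diff)
  also have "integral {?l..?m} (\<lambda>x. 9 / 20 * sqrt t) = 18 / 5 * sqrt t * h"
    using h by simp
  finally show ?thesis using D[OF cf] D[OF cg] by simp
qed

section \<open>Points of small level and windows next to them\<close>

lemma exists_ge_1_of_integral_1:
  fixes f :: "real \<Rightarrow> real"
  assumes cont: "continuous_on {0..1} f" and int: "(LBINT x:{0..1}. f x) = 1"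
  shows "\<exists>x\<in>{0..1}. 1 \<le> f x"
proof -
  obtain z where z: "z \<in> {0..1}" "\<And>x. x \<in> {0..1} \<Longrightarrow> f x \<le> f z"
    using continuous_attains_sup[of "{0..1::real}" f] cont by auto
  have fi: "set_integrable lborel {0..1} f"
    by (rule borel_integrable_atLeastAtMost'[OF cont])
  have "1 = integral {0..1} f"
    using set_borel_integral_eq_integral(2)[OF fi] int by simp
  also have "\<dots> \<le> integral {0..1} (\<lambda>_::real. f z)"
    using z set_borel_integral_eq_integral(1)[OF fi] by (intro integral_le) auto
  finally show ?thesis using z by auto
qed

text \<open>Intermediate values between the minimum, which is at most t, and a point where the value
  is at least 1 >= t.\<close>

lemma attains_small_level:
  fixes f :: "real \<Rightarrow> real"
  assumes cont: "continuous_on {0..1} f" and int: "(LBINT x:{0..1}. f x) = 1"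
    and inf: "(INF x\<in>{0..1}. f x) \<le> t" and t: "t \<le> 1"
  shows "\<exists>x\<in>{0..1}. f x = t"
proof -
  obtain y where y: "y \<in> {0..1}" "1 \<le> f y"
    using exists_ge_1_of_integral_1[OF cont int] by blast
  obtain z where z: "z \<in> {0..1}" "\<And>x. x \<in> {0..1} \<Longrightarrow> f z \<le> f x"
    using continuous_attains_inf[of "{0..1::real}" f] cont by auto
  have "f z \<le> (INF x\<in>{0..1}. f x)"
    using z by (intro cINF_greatest) auto
  then have "f z \<le> t" using inf by simp
  moreover have "connected (f ` {0..1})"
    by (intro connected_continuous_image cont) simp
  ultimately have "t \<in> f ` {0..1}"
    using y z(1) t connectedD_interval[of "f ` {0..1}" "f z" "f y" t] by auto
  then show ?thesis by auto
qed

text \<open>The point x may sit at an end of [0,1], so it becomes an end of the window rather than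
  its centre, and the window extends towards the farther end of [0,1].\<close>

lemma window_exists:
  fixes x L :: real
  assumes "x \<in> {0..1}" "0 < L" "L \<le> 1 / 2"
  shows "\<exists>a\<ge>0. a + L \<le> 1 \<and> (\<forall>y\<in>{a..a + L}. \<bar>y - x\<bar> \<le> L)"
proof (cases "x \<le> 1 / 2")
  case True
  then show ?thesis using assms by (intro exI[of _ x]) auto
next
  case False
  then show ?thesis using assms by (intro exI[of _ "x - L"]) (auto simp: abs_le_iff)
qed

section \<open>Lower bound for the deficiency\<close>

lemma flat_radius_bounds: "0 < flat_radius \<beta>" "flat_radius \<beta> \<le> 1 / 11"
  by (auto simp: flat_radius_def)

text \<open>
  The level \<open>t\<close> at which the density is perturbed: it makes \<open>n t L = 1\<close> for the width
  \<open>L = \<eta> (t / R) powr (1 / \<beta>)\<close> of the neighbourhood on which \<open>f \<approx> t\<close>.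
\<close>

definition critical_level :: "real \<Rightarrow> real \<Rightarrow> real \<Rightarrow> nat \<Rightarrow> real" where
  "critical_level \<beta> R \<eta> n = (R powr (1 / \<beta>) / (\<eta> * real n)) powr (\<beta> / (\<beta> + 1))"

text \<open>The level solves \<eta> n t^(1 + 1/\<beta>) = R^(1/\<beta>). Since \<eta> <= 1, it is at
  least twice the threshold in the hypothesis on the infimum.\<close>

lemma critical_level:
  assumes \<beta>: "0 < \<beta>" and R: "0 < R" and \<eta>: "0 < \<eta>" "\<eta> \<le> 1" and n: "1 \<le> n"
  defines "t \<equiv> critical_level \<beta> R \<eta> n"
  shows "0 < t" and "real n * t * (\<eta> * (t / R) powr (1 / \<beta>)) = 1"
    and "1 / 2 * R powr (1 / (\<beta> + 1)) * real n powr (- \<beta> / (\<beta> + 1)) \<le> t"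
    and "R powr (1 / \<beta>) / \<eta> \<le> real n \<Longrightarrow> t \<le> 1"
proof -
  let ?x = "R powr (1 / \<beta>) / (\<eta> * real n)"
  have x: "0 < ?x" using assms by simp
  then show t: "0 < t" unfolding t_def critical_level_def by (simp only: powr_gt_zero)
  have "t * t powr (1 / \<beta>) = t powr (1 + 1 / \<beta>)"
    using t by (simp add: powr_add)
  also have "1 + 1 / \<beta> = (\<beta> + 1) / \<beta>" using \<beta> by (simp add: field_simps)
  also have "t powr ((\<beta> + 1) / \<beta>) = ?x powr (\<beta> / (\<beta> + 1) * ((\<beta> + 1) / \<beta>))"
    by (simp only: t_def critical_level_def powr_powr)
  also have "\<beta> / (\<beta> + 1) * ((\<beta> + 1) / \<beta>) = 1" using \<beta> by simp
  also have "?x powr 1 = ?x" by (simp only: powr_one_gt_zero_iff less_imp_le[OF x])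
  finally have tt: "t * t powr (1 / \<beta>) = ?x" .
  have "real n * t * (\<eta> * (t / R) powr (1 / \<beta>)) = real n * \<eta> / R powr (1 / \<beta>) * (t * t powr (1 / \<beta>))"
    using t R by (simp add: powr_divide)
  also have "\<dots> = 1" unfolding tt using R n \<eta> by simp
  finally show "real n * t * (\<eta> * (t / R) powr (1 / \<beta>)) = 1" .
  let ?y = "R powr (1 / (\<beta> + 1)) * real n powr (- \<beta> / (\<beta> + 1))"
  have "1 / \<beta> * (\<beta> / (\<beta> + 1)) = 1 / (\<beta> + 1)" using \<beta> by simp
  then have "(R powr (1 / \<beta>) / real n) powr (\<beta> / (\<beta> + 1)) = R powr (1 / (\<beta> + 1)) / real n powr (\<beta> / (\<beta> + 1))"
    by (simp only: powr_divide powr_powr powr_ge_zero of_nat_0_le_iff)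
  then have y: "?y = (R powr (1 / \<beta>) / real n) powr (\<beta> / (\<beta> + 1))"
    by (simp add: powr_minus divide_inverse)
  have "1 / 2 * ?y \<le> 1 * ?y"
    by (intro mult_right_mono) auto
  also have "1 * ?y \<le> t"
    unfolding y t_def critical_level_def mult_1 using R n \<beta> \<eta>
    by (intro powr_mono2 divide_left_mono) auto
  finally show "1 / 2 * R powr (1 / (\<beta> + 1)) * real n powr (- \<beta> / (\<beta> + 1)) \<le> t"
    by (simp only: mult.assoc)
  show "t \<le> 1" if "R powr (1 / \<beta>) / \<eta> \<le> real n"
  proof -
    have "?x \<le> 1" using that \<eta> n by (simp add: field_simps)
    then show ?thesis using x \<beta> unfolding t_def critical_level_def by (intro powr_le1) auto
  qed
qed

text \<open>The bound for a single n. The only asymptotic ingredient is \<open>large\<close>, which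
  ensures t <= 1. The dipole comes in as an argument, so that c can be chosen before R.\<close>

lemma deficiency_bound:
  fixes b :: "real \<Rightarrow> real"
  defines "\<kappa> \<equiv> \<lambda>\<beta>. flat_radius \<beta> / 200"
  assumes \<beta>: "0 < \<beta>" and \<psi>: "derivative_chain (sfloor \<beta>) D M"
    and D0: "D 0 = (\<lambda>x. 3 / 4 * (b (x - 10) - b x))" and b: "\<And>x. 0 \<le> b x" "\<And>x. b x \<le> 1"
    and b1: "\<And>x. x \<in> {1..9} \<Longrightarrow> b x = 1" and b0: "\<And>x. x \<notin> {0..10} \<Longrightarrow> b x = 0"
    and supp: "\<And>j x. j \<le> sfloor \<beta> \<Longrightarrow> x \<notin> {0..20} \<Longrightarrow> D j x = 0" and int0: "(LBINT x. D 0 x) = 0"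
    and c: "perturbation_const \<beta> (\<kappa> \<beta>) M \<le> c" "8 \<le> c"
    and W: "wiener_measure W" and R: "0 < R" and n: "1 \<le> n" and \<Theta>: "\<Theta> \<subseteq> densities01"
    and f\<Theta>: "f \<in> \<Theta>" and f: "f \<in> flat_class \<beta> R"
    and inf: "(INF x\<in>{0..1}. f x) \<le> 1 / 2 * R powr (1 / (\<beta> + 1)) * real n powr (- \<beta> / (\<beta> + 1))"
    and nbhd: "{g \<in> flat_class \<beta> (c * R). \<forall>x\<in>{0..1}. f x / c \<le> g x \<and> g x \<le> c * f x} \<subseteq> \<Theta>"
    and large: "R powr (1 / \<beta>) / flat_radius \<beta> \<le> real n"
  shows "ennreal 0.007 \<le> deficiency \<Theta> (iid_space n) (iid_law n) borel_C01 (white_noise_law W n)"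
proof -
  define \<eta> where "\<eta> = flat_radius \<beta>"
  have \<eta>: "0 < \<eta>" "\<eta> \<le> 1 / 11" using flat_radius_bounds by (auto simp: \<eta>_def)
  then have \<eta>1: "\<eta> \<le> 1" by simp
  define t where "t = critical_level \<beta> R \<eta> n"
  note crit = critical_level[OF \<beta> R \<eta>(1) \<eta>1 n, folded t_def]
  have t: "0 < t" "t \<le> 1" using crit(1,4) large by (auto simp: \<eta>_def)
  have cont: "continuous_on {0..1} f" by (rule continuous_on_flat_class[OF f \<beta> R])
  have fint: "(LBINT x:{0..1}. f x) = 1" using f by (simp add: flat_class_def holder_class_def)
  obtain y where "y \<in> {0..1}" "1 \<le> f y"
    using exists_ge_1_of_integral_1[OF cont fint] by blast
  \<comment> \<open>A continuous density reaches the value 1, so a nonempty class forces R >= 1;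
    this settles small R.\<close>
  then have R1: "1 \<le> R" using flat_classD(2)[OF f \<beta> R, of y] by linarith
  obtain x where x: "x \<in> {0..1}" "f x = t"
    using attains_small_level[OF cont fint order_trans[OF inf crit(3)] t(2)] by blast
  \<comment> \<open>The divisor 200 in \<open>\<kappa>\<close> gives n t h = 1/200 and makes the
    window length 20 h a tenth of the radius on which f stays within 10 percent of t.\<close>
  define h where "h = \<kappa> \<beta> * (t / R) powr (1 / \<beta>)"
  have h: "0 < h" using \<eta> t R by (simp add: h_def \<kappa>_def \<eta>_def)
  have L: "20 * h = 1 / 10 * (\<eta> * (t / R) powr (1 / \<beta>))" by (simp add: h_def \<kappa>_def \<eta>_def)
  have nth: "real n * t * h = 1 / 200"
    using crit(2) by (simp add: h_def \<kappa>_def \<eta>_def)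
  have "(t / R) powr (1 / \<beta>) \<le> 1" using t R1 \<beta> by (intro powr_le1) auto
  then have "\<eta> * (t / R) powr (1 / \<beta>) \<le> 1 / 11 * 1" using \<eta> by (intro mult_mono) auto
  then have "20 * h \<le> 1 / 2" unfolding L by simp
  then obtain a where a: "0 \<le> a" "a + 20 * h \<le> 1" and win: "\<And>y. y \<in> {a..a + 20 * h} \<Longrightarrow> \<bar>y - x\<bar> \<le> 20 * h"
    using window_exists[OF x(1), of "20 * h"] h by auto
  have near: "\<bar>f y - t\<bar> \<le> t / 10" if y: "y \<in> {a..a + 20 * h}" for y
  proof -
    have "0 \<le> \<eta> * (t / R) powr (1 / \<beta>)" using \<eta> by simp
    then have "\<bar>y - x\<bar> \<le> flat_radius \<beta> * (f x / R) powr (1 / \<beta>)"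
      using win[OF y] unfolding L x(2) \<eta>_def[symmetric] by linarith
    moreover have "y \<in> {0..1}" using y a by auto
    ultimately show ?thesis using flat_class_near[OF f \<beta> R x(1), of y] t x(2) by simp
  qed
  define g where "g = perturbation f t a h (D 0)"
  have \<kappa>: "0 < \<kappa> \<beta>" "\<kappa> \<beta> \<le> 1" using \<eta> by (auto simp: \<kappa>_def \<eta>_def)
  note pert = perturbation_in_flat_class[OF \<beta> \<psi> D0 b supp int0 f R1 t \<kappa> h_def a near, folded g_def]
  have pc: "g \<in> flat_class \<beta> (perturbation_const \<beta> (\<kappa> \<beta>) M * R)"
    by (rule pert(1))
  have comp: "f y / 8 \<le> g y \<and> g y \<le> 2 * f y" if "y \<in> {0..1}" for y
    using that by (intro pert(2))
  have "perturbation_const \<beta> (\<kappa> \<beta>) M * R \<le> c * R"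
    using c R by (intro mult_right_mono) auto
  then have gc: "g \<in> flat_class \<beta> (c * R)"
    using pc by (auto simp: flat_class_def holder_class_def intro: order_trans ennreal_leI)
  have "f y / c \<le> g y \<and> g y \<le> c * f y" if y: "y \<in> {0..1}" for y
  proof -
    have f0: "0 \<le> f y" by (rule flat_classD(1)[OF f \<beta> R y])
    have "f y / c \<le> f y / 8" using f0 c by (intro divide_left_mono) auto
    moreover have "2 * f y \<le> c * f y" using f0 c by (intro mult_right_mono) auto
    ultimately show ?thesis using comp[OF y] by linarith
  qed
  then have g\<Theta>: "g \<in> \<Theta>" using nbhd gc by blast
  have cg: "continuous_on {0..1} g"
    using c R by (intro continuous_on_flat_class[OF gc \<beta>]) auto
  have dr: "36 / 5 * sqrt t * h
      \<le> 2 * (LBINT s:{0..a + 9 * h}. sqrt (f s)) - 2 * (LBINT s:{0..a + h}. sqrt (f s))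
        - (2 * (LBINT s:{0..a + 9 * h}. sqrt (g s)) - 2 * (LBINT s:{0..a + h}. sqrt (g s)))"
    using perturbation_drift[OF D0 b1 b0 h t(1) a near cont cg[unfolded g_def]] by (simp add: g_def)
  \<comment> \<open>Because 1600 n t h = 8, the drop 36/5 sqrt t h of the drift is exactly 0.18
    standard deviations of the increment over length 8 h.\<close>
  have "sqrt (8 * h) = 40 * sqrt (real n) * sqrt t * h"
  proof (rule real_sqrt_unique)
    have "(40 * sqrt (real n) * sqrt t * h)\<^sup>2 = 1600 * (real n * t * h) * h"
      using t by (simp add: power_mult_distrib power2_eq_square[of h])
    then show "(40 * sqrt (real n) * sqrt t * h)\<^sup>2 = 8 * h" by (simp add: nth)
  qed (use h t in auto)
  then have "0.18 * sqrt (8 * h) / sqrt (real n) = 36 / 5 * sqrt t * h"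
    using n by simp
  then obtain A where A: "A \<in> sets borel_C01"
    "0.06 \<le> measure (white_noise_law W n g) A - measure (white_noise_law W n f) A"
    using white_noise_gap[OF W n, of f g "a + h" "a + 9 * h"] dr f\<Theta> g\<Theta> \<Theta> a h by auto
  show ?thesis
  proof (rule two_point_deficiency[OF \<Theta> f\<Theta> g\<Theta> _ _ A(1)])
    show "of_nat n * (\<integral>\<^sup>+x\<in>{0..1}. ennreal (g x - f x) \<partial>lborel) \<le> ennreal (3 / 80)"
      unfolding g_def by (rule perturbation_excess_mass[OF D0 b b0 h t(1) nth])
    \<comment> \<open>The left-hand side is 0.0375 + 0.014 = 0.0515, below 0.06.\<close>
    show "3 / 80 + 2 * 0.007 \<le> measure (white_noise_law W n g) A - measure (white_noise_law W n f) A"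
      using A(2) by simp
    show "prob_space (white_noise_law W n u)" if "u \<in> \<Theta>" for u
      using that \<Theta> by (intro prob_space_white_noise_law[OF W _ n]) auto
  qed auto
qed

theorem theorem1:
  fixes \<beta> :: real
  assumes "\<beta> > 0"
  shows "\<exists>c::real. c > 1 \<and>
    (\<forall>(W :: (real \<Rightarrow> real) measure) (R :: real)
       (\<Theta> :: nat \<Rightarrow> (real \<Rightarrow> real) set) (f\<^sub>0 :: nat \<Rightarrow> real \<Rightarrow> real).
      wiener_measure W \<longrightarrow>
      R > 0 \<longrightarrow>
      (\<forall>n\<ge>1. \<Theta> n \<subseteq> densities01) \<longrightarrow>
      (\<forall>n\<ge>1. f\<^sub>0 n \<in> \<Theta> n \<inter> flat_class \<beta> R) \<longrightarrow>
      (\<forall>n\<ge>2. (INF x\<in>{0..1}. f\<^sub>0 n x)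
                \<le> 1 / 2 * R powr (1 / (\<beta> + 1)) * real n powr (- \<beta> / (\<beta> + 1))) \<longrightarrow>
      (\<forall>n\<ge>2. {f \<in> flat_class \<beta> (c * R).
                 \<forall>x\<in>{0..1}. f\<^sub>0 n x / c \<le> f x \<and> f x \<le> c * f\<^sub>0 n x} \<subseteq> \<Theta> n) \<longrightarrow>
      ennreal 0.007 \<le> liminf (\<lambda>n.
        deficiency (\<Theta> n) (iid_space n) (iid_law n) borel_C01 (white_noise_law W n)))"
proof -
  obtain D M b where dip: "derivative_chain (sfloor \<beta>) D M" "D 0 = (\<lambda>x. 3 / 4 * (b (x - 10) - b x))"
    "\<And>x. 0 \<le> b x" "\<And>x. b x \<le> 1" "\<And>x. x \<in> {1..9} \<Longrightarrow> b x = 1" "\<And>x. x \<notin> {0..10} \<Longrightarrow> b x = 0"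
    "\<And>j x. j \<le> sfloor \<beta> \<Longrightarrow> x \<notin> {0..20} \<Longrightarrow> D j x = 0" "(LBINT x. D 0 x) = 0"
    using dipole_exists[of "sfloor \<beta>"] by blast
  \<comment> \<open>Chosen from \<beta> and the dipole alone, before W and R. The maximum with 8
    yields f / c <= f / 8 and 2 f <= c f.\<close>
  define c where "c = max 8 (perturbation_const \<beta> (flat_radius \<beta> / 200) M)"
  show ?thesis
  proof (intro exI[of _ c] conjI allI impI)
    show "c > 1" by (simp add: c_def)
    fix W :: "(real \<Rightarrow> real) measure" and R :: real
      and \<Theta> :: "nat \<Rightarrow> (real \<Rightarrow> real) set" and f\<^sub>0 :: "nat \<Rightarrow> real \<Rightarrow> real"
    assume W: "wiener_measure W" and R: "R > 0" and \<Theta>: "\<forall>n\<ge>1. \<Theta> n \<subseteq> densities01"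
      and f\<^sub>0: "\<forall>n\<ge>1. f\<^sub>0 n \<in> \<Theta> n \<inter> flat_class \<beta> R"
      and inf: "\<forall>n\<ge>2. (INF x\<in>{0..1}. f\<^sub>0 n x)
                \<le> 1 / 2 * R powr (1 / (\<beta> + 1)) * real n powr (- \<beta> / (\<beta> + 1))"
      and nbhd: "\<forall>n\<ge>2. {f \<in> flat_class \<beta> (c * R).
                 \<forall>x\<in>{0..1}. f\<^sub>0 n x / c \<le> f x \<and> f x \<le> c * f\<^sub>0 n x} \<subseteq> \<Theta> n"
    show "ennreal 0.007 \<le> liminf (\<lambda>n.
        deficiency (\<Theta> n) (iid_space n) (iid_law n) borel_C01 (white_noise_law W n))"
    \<comment> \<open>How large n has to be depends on R, but the lower limit ignores finitely many
      n.\<close>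
    proof (rule Liminf_bounded)
      have "\<forall>\<^sub>F n in sequentially. R powr (1 / \<beta>) / flat_radius \<beta> \<le> real n"
        using filterlim_real_sequentially by (simp add: filterlim_at_top)
      then show "\<forall>\<^sub>F n in sequentially. ennreal 0.007
          \<le> deficiency (\<Theta> n) (iid_space n) (iid_law n) borel_C01 (white_noise_law W n)"
        using eventually_ge_at_top[of 2]
      proof eventually_elim
        case (elim n)
        then have n: "1 \<le> n" by simp
        have c: "perturbation_const \<beta> (flat_radius \<beta> / 200) M \<le> c" "8 \<le> c"
          by (simp_all add: c_def)
        have "\<Theta> n \<subseteq> densities01" "f\<^sub>0 n \<in> \<Theta> n" "f\<^sub>0 n \<in> flat_class \<beta> R"
          using \<Theta> f\<^sub>0 n by auto
        from deficiency_bound[OF assms dip c W R n this inf[rule_format, OF elim(2)]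
            nbhd[rule_format, OF elim(2)] elim(1)]
        show ?case .
      qed
    qed
  qed
qed

end
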